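(* Let $\mathcal{A},\mathcal{X},\mathcal{B}\in\mathbb{R}^{n\times n\times n_3}$ with $\mathcal{A}$ and $\mathcal{B}$ symmetric t-positive semidefinite. Then for all positive real numbers $r,p,q$ with $1/p+1/q=1$, $$\big\|\,|\mathcal{A}*\mathcal{X}*\mathcal{B}|^r\,\big\|_F\le n_3^{\frac1{2p}+\frac1{2q}-\frac12}\,\big\|\,|\mathcal{A}^p*\mathcal{X}|^r\,\big\|_F^{1/p}\cdot\big\|\,|\mathcal{X}*\mathcal{B}^q|^r\,\big\|_F^{1/q}$$ and $$\big\|\,|\mathcal{A}*\mathcal{X}*\mathcal{B}|^r\,\big\|_2\le \big\|\,|\mathcal{A}^p*\mathcal{X}|^r\,\big\|_2^{1/p}\cdot\big\|\,|\mathcal{X}*\mathcal{B}^q|^r\,\big\|_2^{1/q}.$$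
   Context: For $\mathcal{A}\in\mathbb{R}^{n_1\times n_2\times n_3}$ with frontal slices $A^{(1)},\dots,A^{(n_3)}$ (each $n_1\times n_2$), $\mathrm{bcirc}(\mathcal{A})$ is the $n_1n_3\times n_2n_3$ block circulant matrix whose first block column is $A^{(1)},A^{(2)},\dots,A^{(n_3)}$ (top to bottom), i.e. its $(i,j)$ block is $A^{(((i-j)\bmod n_3)+1)}$. $\mathrm{unfold}(\mathcal{A})$ is the first block column of $\mathrm{bcirc}(\mathcal{A})$ and $\mathrm{fold}$ is its inverse. The t-product of $\mathcal{A}\in\mathbb{R}^{n_1\times n_2\times n_3}$ and $\mathcal{B}\in\mathbb{R}^{n_2\times n_4\times n_3}$ is $\mathcal{A}*\mathcal{B}=\mathrm{fold}(\mathrm{bcirc}(\mathcal{A})\cdot\mathrm{unfold}(\mathcal{B}))\in\mathbb{R}^{n_1\times n_4\times n_3}$. The transpose $\mathcal{A}^{T}$ is obtained by transposing each frontal slice and reversing the order of the transposed slices $2,\dots,n_3$; $\mathcal{A}$ is symmetric if $\mathcal{A}^T=\mathcal{A}$. The inner product is $\langle\mathcal{X},\mathcal{Y}\rangle=\sum_{i,j,k}x_{ijk}y_{ijk}$. A tensor $\mathcal{A}\in\mathbb{R}^{n\times n\times n_3}$ is symmetric t-positive semidefinite, written $\mathcal{A}\ge0$, if it is symmetric and $\langle\mathcal{X},\mathcal{A}*\mathcal{X}\rangle\ge0$ for all nonzero $\mathcal{X}\in\mathbb{R}^{n\times1\times n_3}$. For $\mathcal{A}\ge0$ and a real number $r>0$,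 the power $\mathcal{A}^r$ (a tensor t-function) is the tensor with $\mathrm{bcirc}(\mathcal{A}^r)=(\mathrm{bcirc}(\mathcal{A}))^r$, the usual power of a positive semidefinite matrix. For any $\mathcal{A}\in\mathbb{R}^{n\times n\times n_3}$, $|\mathcal{A}|=(\mathcal{A}^T*\mathcal{A})^{1/2}$, which is symmetric t-positive semidefinite. Norms: $\|\mathcal{A}\|_F=\sqrt{\sum_{i,j,k}|a_{ijk}|^2}$ and $\|\mathcal{A}\|_2=\|\mathrm{bcirc}(\mathcal{A})\|_2$ (matrix spectral norm). *)

theory Defs
  imports Complex_Main "Jordan_Normal_Form.Matrix"
begin

section \<open>Third-order tensors and the t-product\<close>

text \<open>A tensor of size \<open>n1 \<times> n2 \<times> n3\<close> is the list of its \<open>n3\<close> frontal slices, so the slice written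
  $A^{(k+1)}$ in the usual 1-based numbering is \<open>A ! k\<close>. The first two dimensions are read off
  the first slice; they are meaningful only for \<open>n3 > 0\<close>.\<close>

type_synonym tensor = "real mat list"

definition tensors :: "nat \<Rightarrow> nat \<Rightarrow> nat \<Rightarrow> tensor set" where
  "tensors n1 n2 n3 = {A. length A = n3 \<and> set A \<subseteq> carrier_mat n1 n2}"

definition trows :: "tensor \<Rightarrow> nat" where
  "trows A = dim_row (hd A)"

definition tcols :: "tensor \<Rightarrow> nat" where
  "tcols A = dim_col (hd A)"

text \<open>Entry \<open>(i, j)\<close> lies in block \<open>(i div n1, j div n2)\<close>. Adding \<open>n3\<close> keeps the
  subtraction on natural numbers from truncating.\<close>

definition bcirc :: "tensor \<Rightarrow> real mat" where
  "bcirc A = (let n1 = trows A; n2 = tcols A; n3 = length A in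
     mat (n1 * n3) (n2 * n3) (\<lambda>(i, j).
       A ! ((i div n1 + n3 - j div n2) mod n3) $$ (i mod n1, j mod n2)))"

definition tunfold :: "tensor \<Rightarrow> real mat" where
  "tunfold A = mat (trows A * length A) (tcols A) (\<lambda>(i, j). bcirc A $$ (i, j))"

definition tfold :: "nat \<Rightarrow> real mat \<Rightarrow> tensor" where
  "tfold n3 M = (let n1 = dim_row M div n3 in
     map (\<lambda>k. mat n1 (dim_col M) (\<lambda>(i, j). M $$ (k * n1 + i, j))) [0..<n3])"

definition tprod :: "tensor \<Rightarrow> tensor \<Rightarrow> tensor" (infixl \<open>*\<^sub>t\<close> 70) where
  "A *\<^sub>t B = tfold (length A) (bcirc A * tunfold B)"

definition ttranspose :: "tensor \<Rightarrow> tensor" where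
  "ttranspose A = (case A of [] \<Rightarrow> [] | S # Ss \<Rightarrow> map transpose_mat (S # rev Ss))"

definition tinner :: "tensor \<Rightarrow> tensor \<Rightarrow> real" where
  "tinner X Y = (\<Sum>k<length X. \<Sum>i<trows X. \<Sum>j<tcols X. X ! k $$ (i, j) * Y ! k $$ (i, j))"

definition tzero :: "nat \<Rightarrow> nat \<Rightarrow> nat \<Rightarrow> tensor" where
  "tzero n1 n2 n3 = replicate n3 (0\<^sub>m n1 n2)"

definition sym_tpsd :: "nat \<Rightarrow> nat \<Rightarrow> tensor \<Rightarrow> bool" where
  "sym_tpsd n n3 A \<longleftrightarrow> A \<in> tensors n n n3 \<and> ttranspose A = A \<and>
     (\<forall>X \<in> tensors n 1 n3. X \<noteq> tzero n 1 n3 \<longrightarrow> tinner X (A *\<^sub>t X) \<ge> 0)"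

lemma tensors_dims:
  assumes "A \<in> tensors n1 n2 n3" "0 < n3"
  shows "length A = n3" "trows A = n1" "tcols A = n2"
  using assms by (cases A; auto simp: tensors_def trows_def tcols_def)+

lemma tensors_nth: "A \<in> tensors n1 n2 n3 \<Longrightarrow> k < n3 \<Longrightarrow> A ! k \<in> carrier_mat n1 n2"
  unfolding tensors_def by (metis (mono_tags, lifting) mem_Collect_eq nth_mem subsetD)

lemma tfold_tunfold:
  assumes A: "A \<in> tensors n1 n2 n3" and n3: "0 < n3"
  shows "tfold n3 (tunfold A) = A"
proof (rule nth_equalityI)
  note d = tensors_dims[OF A n3]
  show "length (tfold n3 (tunfold A)) = length A"
    by (simp add: tfold_def Let_def d)
  fix k assume "k < length (tfold n3 (tunfold A))"
  then have k: "k < n3" by (simp add: tfold_def Let_def)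
  have "k * n1 + i < n1 * n3" if "i < n1" for i
  proof -
    have "k * n1 + i < Suc k * n1" using that by simp
    also have "\<dots> \<le> n3 * n1" using k by (intro mult_right_mono) auto
    finally show ?thesis by (simp add: mult.commute)
  qed
  moreover have "j < n2 * n3" if "j < n2" for j
    using that n3 by (metis Suc_leI less_le_trans mult.right_neutral mult_le_mono2 One_nat_def)
  ultimately show "tfold n3 (tunfold A) ! k = A ! k"
    using tensors_nth[OF A k] k
    by (intro eq_matI) (auto simp: tfold_def tunfold_def bcirc_def Let_def d)
qed

section \<open>Powers and norms\<close>

text \<open>The power of a positive semidefinite matrix by functional calculus: \<open>U diag(d) U\<^sup>T\<close> with \<open>U\<close>
  orthogonal and \<open>d \<ge> 0\<close> goes to \<open>U diag(d\<^sup>r) U\<^sup>T\<close>, which does not depend on the chosen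
  decomposition. It is intended for \<open>r > 0\<close>, where \<open>0 powr r = 0\<close> is the correct value.\<close>

definition psd_mat_powr :: "real mat \<Rightarrow> real \<Rightarrow> real mat" where
  "psd_mat_powr M r = (THE N. \<exists>U d. let m = dim_row M in
     U \<in> carrier_mat m m \<and> transpose_mat U * U = 1\<^sub>m m \<and> (\<forall>i<m. 0 \<le> d i) \<and>
     M = U * mat_diag m d * transpose_mat U \<and>
     N = U * mat_diag m (\<lambda>i. d i powr r) * transpose_mat U)"

definition tpowr :: "tensor \<Rightarrow> real \<Rightarrow> tensor" where
  "tpowr A r = (THE B. B \<in> tensors (trows A) (tcols A) (length A) \<and>
     bcirc B = psd_mat_powr (bcirc A) r)"

definition tabs :: "tensor \<Rightarrow> tensor" where
  "tabs A = tpowr (ttranspose A *\<^sub>t A) (1 / 2)"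

definition tnorm_F :: "tensor \<Rightarrow> real" where
  "tnorm_F A = sqrt (\<Sum>k<length A. \<Sum>i<trows A. \<Sum>j<tcols A. \<bar>A ! k $$ (i, j)\<bar>\<^sup>2)"

definition vec_norm2 :: "real vec \<Rightarrow> real" where
  "vec_norm2 v = sqrt (v \<bullet> v)"

definition spectral_norm :: "real mat \<Rightarrow> real" where
  "spectral_norm M = Sup {vec_norm2 (M *\<^sub>v v) | v. v \<in> carrier_vec (dim_col M) \<and> vec_norm2 v = 1}"

definition tnorm_2 :: "tensor \<Rightarrow> real" where
  "tnorm_2 A = spectral_norm (bcirc A)"

end

theory Submission
  imports Defs "Jordan_Normal_Form.Char_Poly" "HOL-Combinatorics.List_Permutation"
begin

text \<open>
  The map \<open>bcirc\<close> is an injective algebra homomorphism onto the matrices that are invariant under the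
  cyclic shift of the blocks. It turns the tensor transpose into the matrix transpose, it multiplies
  the squared Frobenius norm by \<open>n3\<close>, and its image is closed under the functional calculus. So both
  inequalities are statements about the singular values \<open>s i\<close> of real square matrices: the Frobenius
  norm of \<open>|C|\<^sup>r\<close> is the square root of \<open>(\<Sum>i. s i powr (2 * r)) / n3\<close> and the spectral norm is
  \<open>s 0 powr r\<close>. As \<open>1/p + 1/q = 1\<close>, the exponent of \<open>n3\<close> in the statement vanishes.

  For all exponents \<open>r > 0\<close> at once, the sum inequality follows from a log-majorisation: for every \<open>k\<close>,
  the product \<open>v k\<close> of the \<open>k\<close> largest singular values satisfies
  \<open>v k (A X B) \<le> v k (A\<^sup>p X) powr (1/p) * v k (X B\<^sup>q) powr (1/q)\<close> (lemma \<open>kvol_interpolation\<close>). The case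
  \<open>k = 1\<close> is the spectral inequality. The products for all \<open>k\<close> compare the sums of the \<open>2r\<close>-th powers
  (\<open>sum_le_of_prod_le\<close>), and Hoelder's inequality separates the two factors.

  The number \<open>v k M\<close> is the largest factor by which \<open>M\<close> stretches \<open>k\<close>-dimensional volume; the squared
  volume spanned by the columns of \<open>W\<close> is the Gram determinant of \<open>W\<close> (\<open>det_gram_le_kvol\<close>,
  \<open>det_gram_attained\<close>). This makes \<open>v k\<close> submultiplicative, without exterior powers. A further
  property replaces the usual argument with spectral radii: if \<open>M\<^sup>T M = G H\<close>, then \<open>(v k M)\<^sup>2 \<le> v k (H G)\<close>
  (\<open>kvol_sq_le_kvol_swap\<close>), because \<open>H\<close> maps the leading eigenvectors of \<open>G H\<close> to eigenvectors of \<open>H G\<close>.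

  For the interpolation put \<open>f t = v k (A powr (p t) * X * B powr (q (1 - t)))\<close>. Moving one factor around by
  the swap inequality gives \<open>(f t)\<^sup>2 \<le> f 0 * f (2 t)\<close> on the left half of the unit interval and
  \<open>(f t)\<^sup>2 \<le> f 1 * f (2 t - 1)\<close> on the right half. A bounded function with these two properties satisfies
  \<open>f t \<le> f 0 powr (1 - t) * f 1 powr t\<close> (\<open>doubling_bootstrap\<close>): after division by the right-hand side its
  supremum \<open>S\<close> obeys \<open>S\<^sup>2 \<le> S\<close>. The value \<open>t = 1/p\<close> is the claim.
\<close>

section \<open>Spectral theorem for real symmetric matrices\<close>

definition orth :: "nat \<Rightarrow> real mat \<Rightarrow> bool" where
  "orth m U \<longleftrightarrow> U \<in> carrier_mat m m \<and> transpose_mat U * U = 1\<^sub>m m"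

text \<open>Lemmas about functions of a symmetric matrix compare \<open>udiag U d\<close> for a fixed orthogonal \<open>U\<close> and
  varying \<open>d\<close>, which is why the two ingredients are kept apart.\<close>

definition udiag :: "real mat \<Rightarrow> (nat \<Rightarrow> real) \<Rightarrow> real mat" where
  "udiag U d = U * mat_diag (dim_row U) d * transpose_mat U"

lemma orthD:
  assumes "orth m U"
  shows "U \<in> carrier_mat m m" "transpose_mat U * U = 1\<^sub>m m" "U * transpose_mat U = 1\<^sub>m m"
proof -
  show U: "U \<in> carrier_mat m m" and 1: "transpose_mat U * U = 1\<^sub>m m" using assms by (auto simp: orth_def)
  show "U * transpose_mat U = 1\<^sub>m m"
    using mat_mult_left_right_inverse[OF _ U 1] U by auto
qed

lemma udiag_carrier [simp]: "U \<in> carrier_mat m m \<Longrightarrow> udiag U d \<in> carrier_mat m m"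
  unfolding udiag_def by auto

lemma udiag_dim [simp]: "dim_row (udiag U d) = dim_row U" "dim_col (udiag U d) = dim_row U"
  unfolding udiag_def by auto

lemma mult_carrier_square [simp]:
  "P \<in> carrier_mat m m \<Longrightarrow> Q \<in> carrier_mat m m \<Longrightarrow> P * Q \<in> carrier_mat m m"
  by (rule mult_carrier_mat)

lemma udiag_index:
  assumes U: "U \<in> carrier_mat m m" and i: "i < m" "j < m"
  shows "udiag U d $$ (i, j) = (\<Sum>l<m. U $$ (i, l) * d l * U $$ (j, l))"
  using U i unfolding udiag_def
  by (subst mat_diag_mult_right[of _ m]) (auto simp: scalar_prod_def atLeast0LessThan)

lemma udiag_cong:
  assumes "U \<in> carrier_mat m m" "\<And>i. i < m \<Longrightarrow> d i = e i"
  shows "udiag U d = udiag U e"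
  using assms by (intro eq_matI) (auto simp: udiag_index[of U m] intro!: sum.cong)

lemma transpose_udiag:
  assumes "U \<in> carrier_mat m m"
  shows "transpose_mat (udiag U d) = udiag U d"
  using assms by (intro eq_matI) (auto simp: udiag_index[of U m] mult_ac intro!: sum.cong)

lemma udiag_mult:
  assumes U: "orth m U"
  shows "udiag U d * udiag U e = udiag U (\<lambda>i. d i * e i)"
proof -
  note o = orthD[OF U]
  have [simp]: "dim_row U = m" using o by auto
  have "udiag U d * udiag U e = U * mat_diag m d * (transpose_mat U * (U * mat_diag m e * transpose_mat U))"
    unfolding udiag_def using o by (simp add: assoc_mult_mat[of _ m m _ m _ m])
  also have "\<dots> = U * mat_diag m d * ((transpose_mat U * U) * mat_diag m e * transpose_mat U)"
    using o(1) by (simp add: assoc_mult_mat[of _ m m _ m _ m])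
  also have "\<dots> = U * (mat_diag m d * mat_diag m e) * transpose_mat U"
    unfolding o(2) using o(1)
    by (simp add: assoc_mult_mat[of _ m m _ m _ m] left_mult_one_mat[of _ m m] del: mat_diag_diag)
  finally show ?thesis unfolding udiag_def by simp
qed

lemma udiag_one: "orth m U \<Longrightarrow> udiag U (\<lambda>_. 1) = 1\<^sub>m m"
  using orthD[of m U] unfolding udiag_def by auto

lemma udiag_mult_right:
  assumes U: "orth m U"
  shows "udiag U d * U = U * mat_diag m d"
  using orthD[OF U] unfolding udiag_def
  by (simp add: assoc_mult_mat[of _ m m _ m _ m] right_mult_one_mat[of _ m m])

text \<open>The characteristic polynomial has a complex root \<open>z\<close>. Evaluating the Hermitian form of an eigenvector
  in two ways gives \<open>cnj z = z\<close>, so \<open>z\<close> is a root of the real characteristic polynomial.\<close>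

lemma symmetric_real_eigenvector:
  fixes A :: "real mat"
  assumes A: "A \<in> carrier_mat n n" and sym: "transpose_mat A = A" and n: "0 < n"
  obtains v e where "v \<in> carrier_vec n" "v \<bullet> v = 1" "A *\<^sub>v v = e \<cdot>\<^sub>v v"
proof -
  define C where "C = map_mat complex_of_real A"
  have C: "C \<in> carrier_mat n n" using A by (auto simp: C_def)
  have "degree (char_poly C) = n" using degree_monic_char_poly[OF C] by auto
  then obtain z where z: "poly (char_poly C) z = 0"
    using fundamental_theorem_of_algebra[of "char_poly C"] n
    by (metis constant_degree neq0_conv)
  then obtain w where w: "w \<in> carrier_vec n" "w \<noteq> 0\<^sub>v n" "C *\<^sub>v w = z \<cdot>\<^sub>v w"
    using eigenvalue_root_char_poly[OF C] C unfolding eigenvalue_def eigenvector_def by auto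
  have ev: "(\<Sum>j<n. A $$ (i, j) * w $ j) = z * w $ i" if "i < n" for i
    using arg_cong[OF w(3), of "\<lambda>u. u $ i"] that w(1) A
    by (auto simp: scalar_prod_def C_def atLeast0LessThan)
  define S where "S = (\<Sum>i<n. (cmod (w $ i))\<^sup>2)"
  have S: "S > 0"
  proof -
    obtain i where "i < n" "w $ i \<noteq> 0" using w(1,2) by (metis carrier_vecD eq_vecI index_zero_vec)
    then show ?thesis unfolding S_def by (intro sum_pos2[of _ i]) auto
  qed
  have "cnj z * complex_of_real S = z * complex_of_real S"
  proof -
    have "z * complex_of_real S = (\<Sum>i<n. cnj (w $ i) * (z * w $ i))"
      unfolding S_def by (simp add: sum_distrib_left complex_norm_square mult_ac del: of_real_power)
    also have "\<dots> = (\<Sum>i<n. cnj (w $ i) * (\<Sum>j<n. A $$ (i, j) * w $ j))"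
      by (intro sum.cong) (auto simp: ev)
    also have "\<dots> = (\<Sum>i<n. \<Sum>j<n. A $$ (i, j) * cnj (w $ i) * w $ j)"
      by (simp add: sum_distrib_left mult_ac)
    also have "\<dots> = (\<Sum>j<n. \<Sum>i<n. A $$ (i, j) * cnj (w $ i) * w $ j)" by (rule sum.swap)
    also have "\<dots> = (\<Sum>j<n. \<Sum>i<n. A $$ (j, i) * cnj (w $ i) * w $ j)"
      using A by (intro sum.cong refl, subst (2) sym[symmetric]) auto
    also have "\<dots> = (\<Sum>j<n. w $ j * cnj (\<Sum>i<n. A $$ (j, i) * w $ i))"
      by (simp add: sum_distrib_left mult_ac)
    also have "\<dots> = (\<Sum>j<n. w $ j * cnj (z * w $ j))" by (intro sum.cong) (auto simp: ev)
    also have "\<dots> = cnj z * complex_of_real S"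
      unfolding S_def by (simp add: sum_distrib_left complex_norm_square mult_ac del: of_real_power)
    finally show ?thesis by (simp only: mult.commute)
  qed
  then have "cnj z = z" by (rule mult_right_cancel[THEN iffD1, rotated]) (use S in simp)
  then obtain e where e: "z = complex_of_real e" by (metis Reals_cases Reals_cnj_iff)
  have "complex_of_real (poly (char_poly A) e) = 0"
    using z unfolding C_def e of_real_hom.char_poly_hom[OF A] by simp
  then have "poly (char_poly A) e = 0" by simp
  then obtain v where v: "v \<in> carrier_vec n" "v \<noteq> 0\<^sub>v n" "A *\<^sub>v v = e \<cdot>\<^sub>v v"
    using eigenvalue_root_char_poly[OF A] A unfolding eigenvalue_def eigenvector_def by auto
  have pos: "v \<bullet> v > 0"
  proof -
    obtain i where "i < n" "v $ i \<noteq> 0" using v(1,2) by (metis carrier_vecD eq_vecI index_zero_vec)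
    then show ?thesis using v(1) unfolding scalar_prod_def
      by (intro sum_pos2[of _ i]) (auto simp flip: power2_eq_square)
  qed
  define u where "u = (1 / sqrt (v \<bullet> v)) \<cdot>\<^sub>v v"
  show ?thesis
  proof (rule that[of u e])
    show "u \<in> carrier_vec n" using v by (auto simp: u_def)
    show "u \<bullet> u = 1" using v pos by (auto simp: u_def)
    show "A *\<^sub>v u = e \<cdot>\<^sub>v u" using v A by (auto simp: u_def mult_mat_vec smult_smult_assoc mult.commute)
  qed
qed

lemma orth_mult:
  assumes "orth m U" "orth m V"
  shows "orth m (U * V)"
proof -
  note u = orthD[OF assms(1)] and v = orthD[OF assms(2)]
  have "transpose_mat (U * V) * (U * V) = transpose_mat V * (transpose_mat U * U) * V"
    using u(1) v(1) by (simp add: transpose_mult[of _ m m _ m] assoc_mult_mat[of _ m m _ m _ m])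
  then show ?thesis using u v by (auto simp: orth_def)
qed

text \<open>The Householder reflection that exchanges \<open>v\<close> and the first unit vector. It serves as an orthogonal
  change of basis with first column \<open>v\<close> and is symmetric, hence its own inverse, which avoids a
  Gram-Schmidt completion.\<close>

lemma householder_exists:
  assumes v: "v \<in> carrier_vec n" "v \<bullet> v = 1" and n: "0 < n"
  obtains H where "orth n H" "transpose_mat H = H" "\<And>i. i < n \<Longrightarrow> H $$ (i, 0) = v $ i"
proof (cases "v $ 0 = 1")
  case True
  have "(\<Sum>i<n. (v $ i)\<^sup>2) = 1"
    using v by (simp add: scalar_prod_def atLeast0LessThan power2_eq_square)
  also have "(\<Sum>i<n. (v $ i)\<^sup>2) = (v $ 0)\<^sup>2 + (\<Sum>i\<in>{..<n}-{0}. (v $ i)\<^sup>2)"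
    using n by (subst sum.remove[of _ 0]) auto
  finally have "(\<Sum>i\<in>{..<n}-{0}. (v $ i)\<^sup>2) = 0" using True by simp
  then have "v $ i = 0" if "i < n" "i \<noteq> 0" for i
    using that by (subst (asm) sum_nonneg_eq_0_iff) auto
  then show ?thesis using that[of "1\<^sub>m n"] True n by (auto simp: orth_def)
next
  case False
  define w where "w i = v $ i - (if i = 0 then 1 else 0)" for i
  define s where "s = (\<Sum>i<n. (w i)\<^sup>2)"
  have vv: "(\<Sum>i<n. (v $ i)\<^sup>2) = 1"
    using v by (simp add: scalar_prod_def atLeast0LessThan power2_eq_square)
  have s: "s = 2 - 2 * v $ 0"
  proof -
    have "s = (\<Sum>i<n. (v $ i)\<^sup>2) + (\<Sum>i<n. if i = 0 then 1 - 2 * v $ i else 0)"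
      unfolding s_def w_def sum.distrib[symmetric]
      by (intro sum.cong) (auto simp: power2_eq_square algebra_simps)
    also have "\<dots> = 2 - 2 * v $ 0" using n by (simp add: vv sum.delta)
    finally show ?thesis .
  qed
  then have s0: "s \<noteq> 0" using False by simp
  define H where "H = mat n n (\<lambda>(i, j). (if i = j then 1 else 0) - 2 * w i * w j / s)"
  have H: "H \<in> carrier_mat n n" by (simp add: H_def)
  have symH: "transpose_mat H = H" unfolding H_def by (intro eq_matI) auto
  have "H * H = 1\<^sub>m n"
  proof (intro eq_matI)
    fix i j assume "i < dim_row (1\<^sub>m n)" "j < dim_col (1\<^sub>m n)"
    then have ij: "i < n" "j < n" by auto
    have "(H * H) $$ (i, j) = (\<Sum>l<n. ((if i = l then 1 else 0) - 2 * w i * w l / s) * ((if l = j then 1 else 0) - 2 * w l * w j / s))"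
      using ij by (simp add: H_def scalar_prod_def atLeast0LessThan)
    also have "\<dots> = (\<Sum>l<n. (if i = l then (if l = j then 1 else 0) else 0) - (if i = l then 2 * w l * w j / s else 0)
        - (if l = j then 2 * w i * w l / s else 0) + 4 * w i * w j / s\<^sup>2 * (w l)\<^sup>2)"
      by (intro sum.cong) (auto simp: power2_eq_square algebra_simps)
    also have "\<dots> = (if i = j then 1 else 0) - 2 * w i * w j / s - 2 * w i * w j / s + 4 * w i * w j / s\<^sup>2 * s"
      using ij unfolding s_def sum_distrib_left sum.distrib sum_subtractf by (simp add: sum.delta sum.delta')
    also have "\<dots> = (if i = j then 1 else 0)" using s0 by (simp add: field_simps power2_eq_square)
    finally show "(H * H) $$ (i, j) = 1\<^sub>m n $$ (i, j)" using ij by simp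
  qed (auto simp: H_def)
  moreover have "H $$ (i, 0) = v $ i" if "i < n" for i
  proof -
    have w0: "w 0 = - s / 2" by (simp add: w_def s)
    have "2 * w i * w 0 / s = - w i" unfolding w0 using s0 by simp
    then show ?thesis using that n by (simp add: H_def w_def)
  qed
  ultimately show ?thesis using that[of H] H symH by (auto simp: orth_def)
qed

text \<open>Induction on the size: a Householder reflection moves a unit eigenvector to the first coordinate,
  and by symmetry the reflected matrix splits off its first row and column.\<close>

lemma symmetric_spectral:
  assumes "A \<in> carrier_mat n n" "transpose_mat A = A"
  shows "\<exists>U d. orth n U \<and> A = udiag U d"
  using assms
proof (induction n arbitrary: A)
  case 0
  then show ?case by (intro exI[of _ "1\<^sub>m 0"] exI) (auto simp: orth_def udiag_def)
next
  case (Suc n)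
  note A = Suc.prems(1) and sym = Suc.prems(2)
  obtain v e where v: "v \<in> carrier_vec (Suc n)" "v \<bullet> v = 1" "A *\<^sub>v v = e \<cdot>\<^sub>v v"
    using symmetric_real_eigenvector[OF A sym] by auto
  obtain H where H: "orth (Suc n) H" "transpose_mat H = H" "\<And>i. i < Suc n \<Longrightarrow> H $$ (i, 0) = v $ i"
    using householder_exists[OF v(1,2)] by auto
  note o = orthD[OF H(1)]
  have HH: "H * H = 1\<^sub>m (Suc n)" using o(2) H(2) by simp
  define G where "G = H * A * H"
  have G: "G \<in> carrier_mat (Suc n) (Suc n)" using o A by (auto simp: G_def)
  have symG: "transpose_mat G = G"
    unfolding G_def using o(1) A
    by (simp add: transpose_mult[of _ "Suc n" "Suc n" _ "Suc n"] sym H(2) assoc_mult_mat[of _ "Suc n" "Suc n" _ "Suc n" _ "Suc n"])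
  have colH: "col H 0 = v" using H(3) o(1) v(1) by (intro eq_vecI) auto
  have G0: "G $$ (i, 0) = (if i = 0 then e else 0)" if i: "i < Suc n" for i
  proof -
    define K where "K = H * A"
    have "K \<in> carrier_mat (Suc n) (Suc n)" using o(1) A by (simp add: K_def)
    then have "G $$ (i, 0) = (K *\<^sub>v col H 0) $ i"
      using i o(1) A by (simp add: G_def flip: K_def)
    also note K_def
    also have "(H * A) *\<^sub>v col H 0 = e \<cdot>\<^sub>v (H *\<^sub>v col H 0)"
      unfolding colH using o(1) A v by (simp add: assoc_mult_mat_vec[of _ "Suc n" "Suc n" _ "Suc n"] mult_mat_vec[of _ "Suc n" "Suc n"])
    also have "(\<dots>) $ i = e * (H * H) $$ (i, 0)" using i o(1) by simp
    finally show ?thesis unfolding HH using i by simp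
  qed
  have G0': "G $$ (0, i) = (if i = 0 then e else 0)" if i: "i < Suc n" for i
    using G0[OF i] arg_cong[OF symG, of "\<lambda>M. M $$ (i, 0)"] i G by auto
  define B where "B = mat n n (\<lambda>(i, j). G $$ (Suc i, Suc j))"
  have "transpose_mat B = B"
  proof (intro eq_matI)
    fix i j assume "i < dim_row B" "j < dim_col B"
    then have ij: "i < n" "j < n" by (auto simp: B_def)
    then show "transpose_mat B $$ (i, j) = B $$ (i, j)"
      using arg_cong[OF symG, of "\<lambda>M. M $$ (Suc i, Suc j)"] G by (auto simp: B_def)
  qed (auto simp: B_def)
  from Suc.IH[OF _ this] obtain U d where U: "orth n U" and B: "B = udiag U d" by (auto simp: B_def)
  note u = orthD[OF U]
  define V where "V = mat (Suc n) (Suc n) (\<lambda>(i, j). if i = 0 \<or> j = 0 then (if i = j then 1 else 0) else U $$ (i - 1, j - 1))"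
  define f where "f = (\<lambda>i. case i of 0 \<Rightarrow> e | Suc i \<Rightarrow> d i)"
  have V: "V \<in> carrier_mat (Suc n) (Suc n)" by (simp add: V_def)
  have orthV: "orth (Suc n) V"
    unfolding orth_def
  proof (intro conjI V eq_matI)
    fix i j assume "i < dim_row (1\<^sub>m (Suc n))" "j < dim_col (1\<^sub>m (Suc n))"
    then have ij: "i < Suc n" "j < Suc n" by auto
    have "(transpose_mat V * V) $$ (i, j) = (\<Sum>l<Suc n. V $$ (l, i) * V $$ (l, j))"
      using ij V by (simp add: scalar_prod_def atLeast0LessThan del: sum.lessThan_Suc)
    also have "\<dots> = V $$ (0, i) * V $$ (0, j) + (\<Sum>l<n. V $$ (Suc l, i) * V $$ (Suc l, j))"
      by (rule sum.lessThan_Suc_shift)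
    also have "\<dots> = (if i = j then 1 else 0)"
    proof (cases "i = 0 \<or> j = 0")
      case True
      then show ?thesis using ij by (auto simp: V_def)
    next
      case False
      then obtain i' j' where [simp]: "i = Suc i'" "j = Suc j'" by (metis not0_implies_Suc)
      have "(\<Sum>l<n. U $$ (l, i') * U $$ (l, j')) = (transpose_mat U * U) $$ (i', j')"
        using ij u(1) by (simp add: scalar_prod_def atLeast0LessThan)
      then show ?thesis using ij unfolding u(2) by (simp add: V_def)
    qed
    finally show "(transpose_mat V * V) $$ (i, j) = 1\<^sub>m (Suc n) $$ (i, j)" using ij by simp
  qed (auto simp: V_def)
  have "G = udiag V f"
  proof (intro eq_matI)
    fix i j assume "i < dim_row (udiag V f)" "j < dim_col (udiag V f)"
    then have ij: "i < Suc n" "j < Suc n" using udiag_carrier[OF V, of f] by auto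
    have "udiag V f $$ (i, j) = (\<Sum>l<Suc n. V $$ (i, l) * f l * V $$ (j, l))"
      by (rule udiag_index[OF V ij])
    also have "\<dots> = V $$ (i, 0) * f 0 * V $$ (j, 0) + (\<Sum>l<n. V $$ (i, Suc l) * f (Suc l) * V $$ (j, Suc l))"
      by (rule sum.lessThan_Suc_shift)
    also have "\<dots> = G $$ (i, j)"
    proof (cases "i = 0 \<or> j = 0")
      case True
      then show ?thesis using ij G0 G0' by (auto simp: V_def f_def)
    next
      case False
      then obtain i' j' where [simp]: "i = Suc i'" "j = Suc j'" by (metis not0_implies_Suc)
      have "(\<Sum>l<n. U $$ (i', l) * d l * U $$ (j', l)) = B $$ (i', j')"
        unfolding B using ij udiag_index[OF u(1), of i' j' d] by simp
      then show ?thesis using ij by (simp add: V_def f_def B_def)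
    qed
    finally show "G $$ (i, j) = udiag V f $$ (i, j)" by simp
  qed (use G udiag_carrier[OF V, of f] in auto)
  moreover have "A = H * G * H"
  proof -
    have "H * G * H = (H * H) * A * (H * H)"
      unfolding G_def using o(1) A by (simp add: assoc_mult_mat[of _ "Suc n" "Suc n" _ "Suc n" _ "Suc n"] del: HH)
    then show ?thesis unfolding HH using A by simp
  qed
  ultimately have "A = udiag (H * V) f"
    unfolding udiag_def using o(1) V
    by (simp add: transpose_mult[of _ "Suc n" "Suc n" _ "Suc n"] H(2) assoc_mult_mat[of _ "Suc n" "Suc n" _ "Suc n" _ "Suc n"])
  then show ?case using orth_mult[OF H(1) orthV] by blast
qed

lemma sorting_permutation:
  fixes d :: "nat \<Rightarrow> real"
  obtains \<pi> where "\<pi> permutes {..<n}" "\<And>i j. i \<le> j \<Longrightarrow> j < n \<Longrightarrow> d (\<pi> j) \<le> d (\<pi> i)"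
proof -
  define xs where "xs = map d [0..<n]"
  define ys where "ys = rev (sort xs)"
  have "mset ys = mset xs" by (simp add: ys_def)
  then obtain \<pi> where \<pi>: "\<pi> permutes {..<length xs}" "permute_list \<pi> xs = ys"
    using mset_eq_permutation by blast
  have len: "length xs = n" by (simp add: xs_def)
  have "ys ! i = d (\<pi> i)" if "i < n" for i
    using that \<pi> permutes_in_image[OF \<pi>(1), of i] unfolding \<pi>(2)[symmetric]
    by (simp add: permute_list_nth len) (simp add: xs_def len)
  moreover have "ys ! j \<le> ys ! i" if "i \<le> j" "j < n" for i j
  proof -
    have "sorted_wrt (\<ge>) ys" unfolding ys_def by (simp add: sorted_wrt_rev)
    then show ?thesis using that by (cases "i = j") (auto simp: sorted_wrt_iff_nth_less ys_def len)
  qed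
  ultimately show ?thesis using that[of \<pi>] \<pi>(1) len by (metis le_less_trans)
qed

lemma symmetric_spectral_sorted:
  assumes A: "A \<in> carrier_mat n n" "transpose_mat A = A"
  obtains U d where "orth n U" "A = udiag U d" "\<And>i j. i \<le> j \<Longrightarrow> j < n \<Longrightarrow> d j \<le> d i"
proof -
  obtain U d where U: "orth n U" and AU: "A = udiag U d" using symmetric_spectral[OF A] by auto
  note u = orthD[OF U]
  obtain \<pi> where \<pi>: "\<pi> permutes {..<n}" "\<And>i j. i \<le> j \<Longrightarrow> j < n \<Longrightarrow> d (\<pi> j) \<le> d (\<pi> i)"
    using sorting_permutation by blast
  have lt: "\<pi> i < n" if "i < n" for i using permutes_in_image[OF \<pi>(1), of i] that by simp
  have inj: "\<pi> i = \<pi> j \<longleftrightarrow> i = j" for i j using permutes_inj[OF \<pi>(1)] by (auto dest: injD)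
  define V where "V = mat n n (\<lambda>(i, j). U $$ (i, \<pi> j))"
  have V: "V \<in> carrier_mat n n" by (simp add: V_def)
  have "transpose_mat V * V = 1\<^sub>m n"
  proof (intro eq_matI)
    fix i j assume "i < dim_row (1\<^sub>m n)" "j < dim_col (1\<^sub>m n)"
    then have ij: "i < n" "j < n" by auto
    have "(transpose_mat V * V) $$ (i, j) = (transpose_mat U * U) $$ (\<pi> i, \<pi> j)"
      using ij lt u(1) by (simp add: V_def scalar_prod_def)
    then show "(transpose_mat V * V) $$ (i, j) = 1\<^sub>m n $$ (i, j)" unfolding u(2) using ij lt inj by simp
  qed (auto simp: V_def)
  then have "orth n V" using V by (simp add: orth_def)
  moreover have "A = udiag V (d \<circ> \<pi>)"
  proof (intro eq_matI)
    fix i j assume "i < dim_row (udiag V (d \<circ> \<pi>))" "j < dim_col (udiag V (d \<circ> \<pi>))"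
    then have ij: "i < n" "j < n" using V by auto
    have "A $$ (i, j) = (\<Sum>l<n. U $$ (i, l) * d l * U $$ (j, l))"
      unfolding AU by (rule udiag_index[OF u(1) ij])
    also have "\<dots> = (\<Sum>l<n. U $$ (i, \<pi> l) * d (\<pi> l) * U $$ (j, \<pi> l))"
      by (rule sum.permute[OF \<pi>(1), unfolded comp_def])
    also have "\<dots> = udiag V (d \<circ> \<pi>) $$ (i, j)"
      unfolding udiag_index[OF V ij] using ij by (simp add: V_def)
    finally show "A $$ (i, j) = udiag V (d \<circ> \<pi>) $$ (i, j)" .
  qed (use A V in auto)
  ultimately show ?thesis using that[of V "d \<circ> \<pi>"] \<pi>(2) by auto
qed

section \<open>Gram determinants\<close>

text \<open>A version of the Cauchy-Binet formula with all maps \<open>f\<close> in place of \<open>k\<close>-element subsets. Expanding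
  the determinant gives the sum of \<open>(\<Prod>i. c (f i) * W (f i, i)) * minor f\<close>. Composing \<open>f\<close> with a permutation
  \<open>p\<close> changes \<open>minor f\<close> by the sign of \<open>p\<close>, and summing over all \<open>p\<close> turns the remaining product of
  entries into a second copy of \<open>minor f\<close>. This costs the factor \<open>fact k\<close>.\<close>

lemma gram_diag_sum_squares:
  fixes W :: "real mat"
  assumes W: "W \<in> carrier_mat m k"
  defines "minor f \<equiv> det (mat k k (\<lambda>(i, j). W $$ (f i, j)))"
  shows "fact k * det (transpose_mat W * (mat_diag m c * W))
    = (\<Sum>f\<in>{0..<k} \<rightarrow>\<^sub>E {0..<m}. (\<Prod>i=0..<k. c (f i)) * (minor f)\<^sup>2)"
proof -
  let ?F = "{0..<k} \<rightarrow>\<^sub>E {0..<m}"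
  let ?P = "{p. p permutes {0..<k}}"
  let ?G = "transpose_mat W * (mat_diag m c * W)"
  have G: "?G \<in> carrier_mat k k" using W by auto
  have minor: "minor f = (\<Sum>p\<in>?P. signof p * (\<Prod>i=0..<k. W $$ (f i, p i)))" for f
    unfolding minor_def by (subst det_def'[of _ k]) (auto intro!: sum.cong prod.cong simp: permutes_in_image[of _ "{0..<k}", simplified])
  have expand: "det ?G = (\<Sum>f\<in>?F. (\<Prod>i=0..<k. c (f i)) * (\<Prod>i=0..<k. W $$ (f i, i)) * minor f)"
  proof -
    have "det ?G = (\<Sum>p\<in>?P. signof p * (\<Prod>i=0..<k. \<Sum>l\<in>{0..<m}. c l * W $$ (l, i) * W $$ (l, p i)))"
      unfolding det_def'[OF G]
    proof (intro sum.cong refl arg_cong2[of _ _ _ _ "(*)"] prod.cong)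
      fix p i assume p: "p \<in> ?P" and "i \<in> {0..<k}"
      then have "i < k" "p i < k" using permutes_in_image[of p "{0..<k}" i] by auto
      then show "?G $$ (i, p i) = (\<Sum>l\<in>{0..<m}. c l * W $$ (l, i) * W $$ (l, p i))"
        using W by (auto simp: mat_diag_mult_left[OF W] scalar_prod_def mult_ac intro!: sum.cong)
    qed
    also have "\<dots> = (\<Sum>p\<in>?P. signof p * (\<Sum>f\<in>?F. \<Prod>i=0..<k. c (f i) * W $$ (f i, i) * W $$ (f i, p i)))"
      by (intro sum.cong refl arg_cong2[of _ _ _ _ "(*)"] prod_sum_PiE) auto
    also have "\<dots> = (\<Sum>f\<in>?F. \<Sum>p\<in>?P. signof p * (\<Prod>i=0..<k. c (f i) * W $$ (f i, i) * W $$ (f i, p i)))"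
      unfolding sum_distrib_left by (rule sum.swap)
    also have "\<dots> = (\<Sum>f\<in>?F. (\<Prod>i=0..<k. c (f i)) * (\<Prod>i=0..<k. W $$ (f i, i)) * minor f)"
      unfolding minor sum_distrib_left prod.distrib by (simp add: mult_ac)
    finally show ?thesis .
  qed
  have perm: "det ?G = (\<Sum>f\<in>?F. (\<Prod>i=0..<k. c (f i)) * (signof p * (\<Prod>i=0..<k. W $$ (f i, p i))) * minor f)"
    if "p \<in> ?P" for p
  proof -
    define q where "q = Hilbert_Choice.inv p"
    have p: "p permutes {0..<k}" using that by simp
    then have q: "q permutes {0..<k}" unfolding q_def by (rule permutes_inv)
    have pq: "p (q i) = i" "q (p i) = i" for i
      using permutes_inverses[OF p] by (auto simp: q_def)
    have sgn: "signof q = (signof p :: real)"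
      unfolding q_def using p by (subst sign_inverse) (auto simp: permutation_permutes)
    have maps: "f \<circ> r \<in> ?F" if "f \<in> ?F" "r permutes {0..<k}" for f r
      using that permutes_in_image[OF that(2)] permutes_not_in[OF that(2)] by (auto simp: PiE_iff extensional_def)
    have minorq: "minor (f \<circ> q) = signof q * minor f" for f
    proof -
      have "mat k k (\<lambda>(i, j). W $$ ((f \<circ> q) i, j)) = mat k k (\<lambda>(i, j). mat k k (\<lambda>(i, j). W $$ (f i, j)) $$ (q i, j))"
        using permutes_in_image[OF q] by (intro eq_matI) auto
      then show ?thesis unfolding minor_def
        using det_permute_rows[of "mat k k (\<lambda>(i, j). W $$ (f i, j))" k q] q by simp
    qed
    have "det ?G = (\<Sum>f\<in>?F. (\<Prod>i=0..<k. c ((f \<circ> q) i)) * (\<Prod>i=0..<k. W $$ ((f \<circ> q) i, i)) * minor (f \<circ> q))"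
      unfolding expand
    proof (rule sum.reindex_bij_witness[of _ "\<lambda>f. f \<circ> q" "\<lambda>f. f \<circ> p"])
      fix f assume f: "f \<in> ?F"
      show fpq: "(f \<circ> p) \<circ> q = f" and "(f \<circ> q) \<circ> p = f" by (simp_all add: fun_eq_iff pq)
      show "f \<circ> p \<in> ?F" "f \<circ> q \<in> ?F" using maps f p q by blast+
      show "(\<Prod>i=0..<k. c (((f \<circ> p) \<circ> q) i)) * (\<Prod>i=0..<k. W $$ (((f \<circ> p) \<circ> q) i, i)) * minor ((f \<circ> p) \<circ> q)
        = (\<Prod>i=0..<k. c (f i)) * (\<Prod>i=0..<k. W $$ (f i, i)) * minor f"
        unfolding fpq ..
    qed
    also have "\<dots> = (\<Sum>f\<in>?F. (\<Prod>i=0..<k. c (f i)) * (signof p * (\<Prod>i=0..<k. W $$ (f i, p i))) * minor f)"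
    proof (intro sum.cong refl)
      fix f
      have "(\<Prod>i=0..<k. c ((f \<circ> q) i)) = (\<Prod>i=0..<k. c (f i))"
        using prod.permute[OF q, of "\<lambda>i. c (f i)"] by (simp add: comp_def)
      moreover have "(\<Prod>i=0..<k. W $$ ((f \<circ> q) i, i)) = (\<Prod>i=0..<k. W $$ (f i, p i))"
        using prod.permute[OF p, of "\<lambda>i. W $$ ((f \<circ> q) i, i)"] by (simp add: comp_def pq)
      ultimately show "(\<Prod>i=0..<k. c ((f \<circ> q) i)) * (\<Prod>i=0..<k. W $$ ((f \<circ> q) i, i)) * minor (f \<circ> q)
        = (\<Prod>i=0..<k. c (f i)) * (signof p * (\<Prod>i=0..<k. W $$ (f i, p i))) * minor f"
        by (simp add: minorq sgn mult_ac)
    qed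
    finally show ?thesis .
  qed
  have "card ?P = fact k" by (simp add: card_permutations)
  then have "fact k * det ?G = (\<Sum>p\<in>?P. det ?G)" by simp
  also have "\<dots> = (\<Sum>p\<in>?P. \<Sum>f\<in>?F. (\<Prod>i=0..<k. c (f i)) * (signof p * (\<Prod>i=0..<k. W $$ (f i, p i))) * minor f)"
    using perm by (rule sum.cong[OF refl])
  also have "\<dots> = (\<Sum>f\<in>?F. \<Sum>p\<in>?P. (\<Prod>i=0..<k. c (f i)) * (signof p * (\<Prod>i=0..<k. W $$ (f i, p i))) * minor f)"
    by (rule sum.swap)
  also have "\<dots> = (\<Sum>f\<in>?F. (\<Prod>i=0..<k. c (f i)) * (minor f)\<^sup>2)"
    unfolding power2_eq_square by (subst (2) minor) (simp add: sum_distrib_left sum_distrib_right mult_ac)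
  finally show ?thesis .
qed

text \<open>In the expansion the weight \<open>\<Prod>i. c (f i)\<close> multiplies a square, which vanishes unless \<open>f\<close> is
  injective. So \<open>c\<close> may be replaced by the constant 1 at the cost of the factor \<open>K\<close>.\<close>

lemma gram_diag_bound:
  fixes W :: "real mat"
  assumes W: "W \<in> carrier_mat m k"
    and K: "\<And>f. inj_on f {..<k} \<Longrightarrow> f ` {..<k} \<subseteq> {..<m} \<Longrightarrow> (\<Prod>i<k. c (f i)) \<le> K"
  shows "det (transpose_mat W * (mat_diag m c * W)) \<le> K * det (transpose_mat W * W)"
proof -
  define minor where "minor f = det (mat k k (\<lambda>(i, j). W $$ (f i, j)))" for f :: "nat \<Rightarrow> nat"
  let ?F = "{0..<k} \<rightarrow>\<^sub>E {0..<m}"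
  have "fact k * det (transpose_mat W * (mat_diag m c * W)) = (\<Sum>f\<in>?F. (\<Prod>i=0..<k. c (f i)) * (minor f)\<^sup>2)"
    using gram_diag_sum_squares[OF W, of c] unfolding minor_def .
  also have "\<dots> \<le> (\<Sum>f\<in>?F. K * (minor f)\<^sup>2)"
  proof (rule sum_mono)
    fix f assume f: "f \<in> ?F"
    show "(\<Prod>i=0..<k. c (f i)) * (minor f)\<^sup>2 \<le> K * (minor f)\<^sup>2"
    proof (cases "inj_on f {..<k}")
      case True
      then show ?thesis using K[of f] f
        by (intro mult_right_mono) (auto simp: atLeast0LessThan PiE_iff)
    next
      case False
      then obtain i j where ij: "i \<noteq> j" "i < k" "j < k" "f i = f j" by (auto simp: inj_on_def)
      have "minor f = 0" unfolding minor_def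
        by (rule det_identical_rows[OF _ ij(1-3)]) (use ij in \<open>auto intro!: eq_vecI\<close>)
      then show ?thesis by simp
    qed
  qed
  also have "\<dots> = K * (\<Sum>f\<in>?F. (\<Prod>i=0..<k. (\<lambda>_. 1) (f i)) * (minor f)\<^sup>2)" by (simp add: sum_distrib_left)
  also have "\<dots> = K * (fact k * det (transpose_mat W * (mat_diag m (\<lambda>_. 1) * W)))"
    using gram_diag_sum_squares[OF W, of "\<lambda>_. 1"] unfolding minor_def by simp
  also have "\<dots> = fact k * (K * det (transpose_mat W * W))" using W by simp
  finally show ?thesis by simp
qed

lemma det_gram_nonneg:
  fixes W :: "real mat"
  assumes W: "W \<in> carrier_mat m k"
  shows "0 \<le> det (transpose_mat W * W)"
proof -
  have "0 \<le> fact k * det (transpose_mat W * (mat_diag m (\<lambda>_. 1) * W))"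
    unfolding gram_diag_sum_squares[OF W] by (intro sum_nonneg) auto
  then show ?thesis using W fact_gt_zero[of k, where ?'a = real] by (auto simp: zero_le_mult_iff)
qed

text \<open>Induction on the number of indices: the largest of \<open>k + 1\<close> distinct indices is at least \<open>k\<close>.\<close>

lemma prod_inj_le_prod_initial:
  fixes s :: "nat \<Rightarrow> real"
  assumes inj: "inj_on f {..<k}" and sub: "f ` {..<k} \<subseteq> {..<m}"
    and mono: "\<And>i j. i \<le> j \<Longrightarrow> j < m \<Longrightarrow> s j \<le> s i" and nonneg: "\<And>i. i < m \<Longrightarrow> 0 \<le> s i"
  shows "(\<Prod>i<k. s (f i)) \<le> (\<Prod>i<k. s i)"
proof -
  have set: "prod s S \<le> (\<Prod>i<card S. s i)" if "finite S" "S \<subseteq> {..<m}" for S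
    using that
  proof (induction "card S" arbitrary: S)
    case 0
    then show ?case by simp
  next
    case (Suc k S)
    define x where "x = Max S"
    have ne: "S \<noteq> {}" using Suc.hyps(2) by auto
    have x: "x \<in> S" unfolding x_def using ne Suc.prems by auto
    have "S \<subseteq> {..x}" unfolding x_def using Suc.prems by auto
    then have "Suc k \<le> Suc x" using card_mono[of "{..x}" S] Suc.hyps(2) by simp
    then have sx: "s x \<le> s k" using x Suc.prems by (intro mono) auto
    have c: "card (S - {x}) = k" using x Suc.hyps(2) Suc.prems by simp
    have "prod s S = prod s (S - {x}) * s x" using x Suc.prems by (subst prod.remove[of _ x]) auto
    also have "\<dots> \<le> (\<Prod>i<k. s i) * s k"
      using Suc.hyps(1)[of "S - {x}"] c Suc.prems sx x nonneg \<open>Suc k \<le> Suc x\<close>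
      by (intro mult_mono prod_nonneg) (auto simp: subset_iff)
    finally show ?case by (simp flip: Suc.hyps(2))
  qed
  have "(\<Prod>i<k. s (f i)) = prod s (f ` {..<k})" using inj by (simp add: prod.reindex)
  also have "\<dots> \<le> (\<Prod>i<k. s i)" using set[of "f ` {..<k}"] sub inj by (simp add: card_image)
  finally show ?thesis .
qed

section \<open>Singular values and volume growth\<close>

text \<open>The columns of \<open>U\<close> are right singular vectors. Phrased for \<open>M\<^sup>T M\<close> alone, the decomposition is an
  instance of the spectral theorem, and singular \<open>M\<close> need no separate treatment.\<close>

definition svd :: "nat \<Rightarrow> real mat \<Rightarrow> real mat \<Rightarrow> (nat \<Rightarrow> real) \<Rightarrow> bool" where
  "svd m M U s \<longleftrightarrow> orth m U \<and> transpose_mat M * M = udiag U (\<lambda>i. (s i)\<^sup>2) \<and>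
     (\<forall>i j. i \<le> j \<longrightarrow> j < m \<longrightarrow> s j \<le> s i) \<and> (\<forall>i<m. 0 \<le> s i)"

definition svals :: "real mat \<Rightarrow> nat \<Rightarrow> real" where
  "svals M = (SOME s. \<exists>U. svd (dim_row M) M U s)"

text \<open>The norm of the \<open>k\<close>-th exterior power of \<open>M\<close>, that is, the maximal growth of \<open>k\<close>-dimensional volume.\<close>

definition kvol :: "nat \<Rightarrow> real mat \<Rightarrow> real" where
  "kvol k M = (\<Prod>i<k. svals M i)"

lemma svd_exists:
  assumes M: "M \<in> carrier_mat m m"
  obtains U where "svd m M U (svals M)"
proof -
  have sym: "transpose_mat (transpose_mat M * M) = transpose_mat M * M"
    using M by (simp add: transpose_mult[of _ m m _ m])
  obtain U d where U: "orth m U" and MU: "transpose_mat M * M = udiag U d"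
    and d: "\<And>i j. i \<le> j \<Longrightarrow> j < m \<Longrightarrow> d j \<le> d i"
    using symmetric_spectral_sorted[OF mult_carrier_square[OF transpose_carrier_mat[THEN iffD2, OF M] M] sym] by blast
  note u = orthD[OF U]
  have nonneg: "0 \<le> d i" if i: "i < m" for i
  proof -
    have "transpose_mat (M * U) * (M * U) = transpose_mat U * ((transpose_mat M * M) * U)"
      using M u(1) by (simp add: transpose_mult[of _ m m _ m] assoc_mult_mat[of _ m m _ m _ m])
    also have "\<dots> = (transpose_mat U * U) * mat_diag m d"
      unfolding MU udiag_mult_right[OF U] using u(1) by (simp add: assoc_mult_mat[of _ m m _ m _ m])
    also have "\<dots> = mat_diag m d" unfolding u(2) by (rule left_mult_one_mat[of _ m m]) simp
    finally have eq: "transpose_mat (M * U) * (M * U) = mat_diag m d" .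
    define N where "N = M * U"
    have N: "N \<in> carrier_mat m m" using M u(1) by (simp add: N_def)
    have "d i = (transpose_mat N * N) $$ (i, i)" unfolding N_def eq using i by (simp add: mat_diag_def)
    also have "\<dots> = (\<Sum>l<m. (N $$ (l, i))\<^sup>2)"
      using i N by (simp add: scalar_prod_def power2_eq_square atLeast0LessThan)
    finally show ?thesis by (simp add: sum_nonneg)
  qed
  have "svd m M U (\<lambda>i. sqrt (d i))"
    unfolding svd_def using U d nonneg MU u(1) by (auto intro!: udiag_cong[of U m])
  then have "\<exists>s U. svd (dim_row M) M U s" using M by auto
  then have "\<exists>U. svd (dim_row M) M U (svals M)" unfolding svals_def by (rule someI_ex)
  then show ?thesis using that M by auto
qed

lemma svals_props:
  assumes M: "M \<in> carrier_mat m m"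
  shows "i < m \<Longrightarrow> 0 \<le> svals M i" "i \<le> j \<Longrightarrow> j < m \<Longrightarrow> svals M j \<le> svals M i"
proof -
  obtain U where "svd m M U (svals M)" using svd_exists[OF M] .
  then show "i < m \<Longrightarrow> 0 \<le> svals M i" "i \<le> j \<Longrightarrow> j < m \<Longrightarrow> svals M j \<le> svals M i"
    unfolding svd_def by blast+
qed

lemma kvol_nonneg: "M \<in> carrier_mat m m \<Longrightarrow> k \<le> m \<Longrightarrow> 0 \<le> kvol k M"
  unfolding kvol_def by (intro prod_nonneg) (auto intro: svals_props)

lemma gram_udiag:
  assumes M: "M \<in> carrier_mat m m" and U: "orth m U" and MU: "transpose_mat M * M = udiag U e"
    and W: "W \<in> carrier_mat m k"
  shows "transpose_mat (M * W) * (M * W)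
    = transpose_mat (transpose_mat U * W) * (mat_diag m e * (transpose_mat U * W))"
proof -
  note u = orthD[OF U]
  have UW: "transpose_mat U * W \<in> carrier_mat m k" using u(1) W by auto
  have "transpose_mat (M * W) * (M * W) = transpose_mat W * ((transpose_mat M * M) * W)"
    using M W by (simp add: transpose_mult[of _ m m _ k] assoc_mult_mat[of _ k m _ m _ k] assoc_mult_mat[of _ m m _ m _ k])
  also have "\<dots> = transpose_mat W * (U * (mat_diag m e * (transpose_mat U * W)))"
    unfolding MU udiag_def using u(1) W by (simp add: assoc_mult_mat[of _ m m _ m _ k])
  also have "\<dots> = (transpose_mat W * U) * (mat_diag m e * (transpose_mat U * W))"
    using u(1) W UW by (subst assoc_mult_mat[of _ k m _ m _ k]) (auto intro!: mult_carrier_mat[of _ m m])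
  finally show ?thesis using u(1) W by (simp add: transpose_mult[of _ m m _ k])
qed

lemma gram_orth:
  assumes U: "orth m U" and W: "W \<in> carrier_mat m k"
  shows "transpose_mat (transpose_mat U * W) * (transpose_mat U * W) = transpose_mat W * W"
proof -
  note u = orthD[OF U]
  have "transpose_mat (transpose_mat U * W) * (transpose_mat U * W) = transpose_mat W * ((U * transpose_mat U) * W)"
    using u(1) W by (simp add: transpose_mult[of _ m m _ k] assoc_mult_mat[of _ k m _ m _ k] assoc_mult_mat[of _ m m _ m _ k])
  then show ?thesis unfolding u(3) using W by simp
qed

text \<open>In the orthonormal basis of right singular vectors the Gram matrix of \<open>M W\<close> is that of \<open>W\<close> weighted by the
  squared singular values, and \<open>k\<close> distinct weights have a product of at most \<open>(kvol k M)\<^sup>2\<close>.\<close>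

lemma det_gram_le_kvol:
  assumes M: "M \<in> carrier_mat m m" and W: "W \<in> carrier_mat m k"
  shows "det (transpose_mat (M * W) * (M * W)) \<le> (kvol k M)\<^sup>2 * det (transpose_mat W * W)"
proof -
  obtain U where U: "svd m M U (svals M)" using svd_exists[OF M] .
  have "det (transpose_mat (M * W) * (M * W))
    = det (transpose_mat (transpose_mat U * W) * (mat_diag m (\<lambda>i. (svals M i)\<^sup>2) * (transpose_mat U * W)))"
    using U unfolding svd_def by (intro arg_cong[of _ _ det] gram_udiag[OF M _ _ W]) auto
  also have "\<dots> \<le> (kvol k M)\<^sup>2 * det (transpose_mat (transpose_mat U * W) * (transpose_mat U * W))"
  proof (rule gram_diag_bound)
    show "transpose_mat U * W \<in> carrier_mat m k" using U W unfolding svd_def orth_def by auto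
    show "(\<Prod>i<k. (svals M (f i))\<^sup>2) \<le> (kvol k M)\<^sup>2" if "inj_on f {..<k}" "f ` {..<k} \<subseteq> {..<m}" for f
      unfolding kvol_def prod_power_distrib[symmetric]
      using prod_inj_le_prod_initial[OF that, of "svals M"] svals_props[OF M] that
      by (intro power_mono) (auto intro!: prod_nonneg)
  qed
  also have "\<dots> = (kvol k M)\<^sup>2 * det (transpose_mat W * W)"
    using gram_orth[OF _ W] U unfolding svd_def by simp
  finally show ?thesis .
qed

lemma det_mat_diag: "det (mat_diag k e) = (\<Prod>i<k. e i :: real)"
  by (subst det_upper_triangular[of _ k])
     (auto simp: mat_diag_def upper_triangular_def prod_list_diag_prod atLeast0LessThan)

lemma kvol_attained:
  assumes M: "M \<in> carrier_mat m m" and k: "k \<le> m"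
  obtains V where "V \<in> carrier_mat m k" "transpose_mat V * V = 1\<^sub>m k"
    "transpose_mat M * M * V = V * mat_diag k (\<lambda>i. (svals M i)\<^sup>2)"
proof -
  obtain U where "svd m M U (svals M)" using svd_exists[OF M] .
  then have U: "orth m U" and MU: "transpose_mat M * M = udiag U (\<lambda>i. (svals M i)\<^sup>2)"
    unfolding svd_def by auto
  note u = orthD[OF U]
  define V where "V = mat m k (\<lambda>(i, j). U $$ (i, j))"
  have V: "V \<in> carrier_mat m k" by (simp add: V_def)
  have col: "col V j = col U j" if "j < k" for j
    using that k u(1) by (intro eq_vecI) (auto simp: V_def)
  have "transpose_mat V * V = 1\<^sub>m k"
  proof (intro eq_matI)
    fix i j assume "i < dim_row (1\<^sub>m k)" "j < dim_col (1\<^sub>m k)"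
    then have ij: "i < k" "j < k" by auto
    have "(transpose_mat V * V) $$ (i, j) = (transpose_mat U * U) $$ (i, j)"
      using ij k V u(1) by (simp add: col)
    then show "(transpose_mat V * V) $$ (i, j) = 1\<^sub>m k $$ (i, j)" unfolding u(2) using ij k by simp
  qed (auto simp: V_def)
  moreover have "transpose_mat M * M * V = V * mat_diag k (\<lambda>i. (svals M i)\<^sup>2)"
  proof (intro eq_matI)
    fix i j assume "i < dim_row (V * mat_diag k (\<lambda>i. (svals M i)\<^sup>2))" "j < dim_col (V * mat_diag k (\<lambda>i. (svals M i)\<^sup>2))"
    then have ij: "i < m" "j < k" using V by (auto simp: mat_diag_def)
    define N where "N = transpose_mat M * M"
    have N: "N \<in> carrier_mat m m" using M by (simp add: N_def)
    have "(N * V) $$ (i, j) = (N * U) $$ (i, j)" using ij k V u(1) N by (simp add: col)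
    also have "\<dots> = (V * mat_diag k (\<lambda>i. (svals M i)\<^sup>2)) $$ (i, j)"
      unfolding N_def MU udiag_mult_right[OF U] mat_diag_mult_right[OF u(1)] mat_diag_mult_right[OF V]
      using ij k by (simp add: V_def)
    finally show "(transpose_mat M * M * V) $$ (i, j) = (V * mat_diag k (\<lambda>i. (svals M i)\<^sup>2)) $$ (i, j)"
      by (simp add: N_def)
  qed (use M V in \<open>auto simp: mat_diag_def\<close>)
  ultimately show ?thesis using that V by blast
qed

lemma det_gram_attained:
  assumes M: "M \<in> carrier_mat m m" and k: "k \<le> m"
  obtains V where "V \<in> carrier_mat m k" "transpose_mat V * V = 1\<^sub>m k"
    "det (transpose_mat (M * V) * (M * V)) = (kvol k M)\<^sup>2"
proof -
  obtain V where V: "V \<in> carrier_mat m k" "transpose_mat V * V = 1\<^sub>m k"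
    "transpose_mat M * M * V = V * mat_diag k (\<lambda>i. (svals M i)\<^sup>2)"
    using kvol_attained[OF M k] .
  have "transpose_mat (M * V) * (M * V) = transpose_mat V * (transpose_mat M * M * V)"
    using M V(1) by (simp add: transpose_mult[of _ m m _ k] assoc_mult_mat[of _ k m _ m _ k] assoc_mult_mat[of _ m m _ m _ k])
  also have "\<dots> = transpose_mat V * V * mat_diag k (\<lambda>i. (svals M i)\<^sup>2)"
    unfolding V(3) using V(1) by (subst assoc_mult_mat[of _ k m _ k _ k]) auto
  also have "\<dots> = mat_diag k (\<lambda>i. (svals M i)\<^sup>2)" unfolding V(2) by (rule left_mult_one_mat[of _ k k]) simp
  finally have "det (transpose_mat (M * V) * (M * V)) = (kvol k M)\<^sup>2"
    by (simp only: det_mat_diag kvol_def prod_power_distrib)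
  then show ?thesis using that[OF V(1,2)] by blast
qed

lemma kvol_mult_le:
  assumes C: "C \<in> carrier_mat m m" and D: "D \<in> carrier_mat m m" and k: "k \<le> m"
  shows "kvol k (C * D) \<le> kvol k C * kvol k D"
proof -
  obtain V where V: "V \<in> carrier_mat m k" "transpose_mat V * V = 1\<^sub>m k"
    "det (transpose_mat (C * D * V) * (C * D * V)) = (kvol k (C * D))\<^sup>2"
    using det_gram_attained[OF mult_carrier_square[OF C D] k] .
  have "(kvol k (C * D))\<^sup>2 = det (transpose_mat (C * (D * V)) * (C * (D * V)))"
    unfolding V(3)[symmetric] assoc_mult_mat[OF C D V(1)] ..
  also have "\<dots> \<le> (kvol k C)\<^sup>2 * det (transpose_mat (D * V) * (D * V))"
    using D V(1) by (intro det_gram_le_kvol[OF C]) auto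
  also have "\<dots> \<le> (kvol k C)\<^sup>2 * ((kvol k D)\<^sup>2 * det (transpose_mat V * V))"
    by (intro mult_left_mono det_gram_le_kvol[OF D V(1)]) auto
  also have "\<dots> = (kvol k C * kvol k D)\<^sup>2" unfolding V(2) by (simp add: power_mult_distrib)
  finally show ?thesis using kvol_nonneg[OF C k] kvol_nonneg[OF D k] by (auto intro: power2_le_imp_le)
qed

text \<open>Let \<open>V\<close> hold \<open>k\<close> leading eigenvectors, \<open>G H V = V L\<close> with \<open>L\<close> diagonal. Then \<open>W = H V\<close> satisfies
  \<open>H G W = W L\<close>, so \<open>H G\<close> stretches the volume spanned by \<open>W\<close> by the factor \<open>det L = (kvol k M)\<^sup>2\<close>. If \<open>L\<close> is
  invertible, that volume is positive because \<open>G W = V L\<close> has full rank.\<close>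

lemma kvol_sq_le_kvol_swap:
  assumes M: "M \<in> carrier_mat m m" and G: "G \<in> carrier_mat m m" and H: "H \<in> carrier_mat m m"
    and k: "k \<le> m" and eq: "transpose_mat M * M = G * H"
  shows "(kvol k M)\<^sup>2 \<le> kvol k (H * G)"
proof (cases "kvol k M = 0")
  case True
  then show ?thesis using kvol_nonneg[of "H * G" m k] G H k by simp
next
  case False
  define L where "L = mat_diag k (\<lambda>i. (svals M i)\<^sup>2)"
  have L: "L \<in> carrier_mat k k" by (simp add: L_def)
  have Lt: "transpose_mat L = L" unfolding L_def mat_diag_def by (intro eq_matI) auto
  have detL: "det L = (kvol k M)\<^sup>2" by (simp only: L_def det_mat_diag kvol_def prod_power_distrib)
  obtain V where V: "V \<in> carrier_mat m k" "transpose_mat V * V = 1\<^sub>m k" "G * H * V = V * L"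
    using kvol_attained[OF M k] unfolding eq L_def .
  define W where "W = H * V"
  have W: "W \<in> carrier_mat m k" using H V by (simp add: W_def)
  have GW: "G * W = V * L" unfolding W_def using V G H by (simp add: assoc_mult_mat[of _ m m _ m _ k])
  have HGW: "H * G * W = W * L"
    using G H W V(1) L by (simp add: assoc_mult_mat[of _ m m _ m _ k] GW) (simp add: W_def assoc_mult_mat[of _ m m _ k _ k])
  have gram: "det (transpose_mat (Y * L) * (Y * L)) = ((kvol k M)\<^sup>2)\<^sup>2 * det (transpose_mat Y * Y)"
    if Y: "Y \<in> carrier_mat m k" for Y
  proof -
    have "transpose_mat (Y * L) * (Y * L) = L * (transpose_mat Y * Y) * L"
      using Y L by (simp add: transpose_mult[of _ m k _ k] Lt assoc_mult_mat[of _ k m _ k _ k] assoc_mult_mat[of _ k k _ m _ k] assoc_mult_mat[of _ k k _ k _ k])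
    then show ?thesis using Y L by (simp add: det_mult[of _ k] detL power2_eq_square)
  qed
  have "0 < ((kvol k M)\<^sup>2)\<^sup>2" using False by simp
  also have "\<dots> = det (transpose_mat (G * W) * (G * W))" unfolding GW gram[OF V(1)] V(2) by simp
  also have "\<dots> \<le> (kvol k G)\<^sup>2 * det (transpose_mat W * W)" by (rule det_gram_le_kvol[OF G W])
  finally have pos: "0 < det (transpose_mat W * W)"
    using det_gram_nonneg[OF W] by (cases "det (transpose_mat W * W) = 0") auto
  have "((kvol k M)\<^sup>2)\<^sup>2 * det (transpose_mat W * W) \<le> (kvol k (H * G))\<^sup>2 * det (transpose_mat W * W)"
    using det_gram_le_kvol[of "H * G" m W k] G H W unfolding HGW gram[OF W] by simp
  then have "((kvol k M)\<^sup>2)\<^sup>2 \<le> (kvol k (H * G))\<^sup>2" using pos by simp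
  then show ?thesis using kvol_nonneg[of "H * G" m k] G H k by (auto intro: power2_le_imp_le)
qed

text \<open>The swap inequality for \<open>M\<^sup>T M\<close> gives \<open>(kvol k M)\<^sup>2 \<le> kvol k (M M\<^sup>T) \<le> kvol k M * kvol k M\<^sup>T\<close>.\<close>

lemma kvol_transpose:
  assumes M: "M \<in> carrier_mat m m" and k: "k \<le> m"
  shows "kvol k (transpose_mat M) = kvol k M"
proof -
  have le: "kvol k N \<le> kvol k (transpose_mat N)" if N: "N \<in> carrier_mat m m" for N
  proof (cases "kvol k N = 0")
    case True
    then show ?thesis using kvol_nonneg[of "transpose_mat N" m k] N k by simp
  next
    case False
    then have pos: "0 < kvol k N" using kvol_nonneg[OF N k] by simp
    have "(kvol k N)\<^sup>2 \<le> kvol k (N * transpose_mat N)"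
      by (rule kvol_sq_le_kvol_swap[OF N _ _ k refl]) (use N in auto)
    also have "\<dots> \<le> kvol k N * kvol k (transpose_mat N)" using N k by (intro kvol_mult_le) auto
    finally show ?thesis using pos by (simp add: power2_eq_square)
  qed
  show ?thesis using le[OF M] le[of "transpose_mat M"] M by simp
qed

text \<open>A crude bound, needed only to know that the function to be interpolated is bounded.\<close>

lemma kvol_udiag_le:
  assumes U: "orth m U" and k: "k \<le> m" and c: "\<And>i. i < m \<Longrightarrow> \<bar>c i\<bar> \<le> K" and K: "0 \<le> K"
  shows "kvol k (udiag U c) \<le> K ^ k"
proof -
  note u = orthD[OF U]
  have M: "udiag U c \<in> carrier_mat m m" using u(1) by simp
  obtain V where V: "V \<in> carrier_mat m k" "transpose_mat V * V = 1\<^sub>m k"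
    "det (transpose_mat (udiag U c * V) * (udiag U c * V)) = (kvol k (udiag U c))\<^sup>2"
    using det_gram_attained[OF M k] .
  have eq: "transpose_mat (udiag U c) * udiag U c = udiag U (\<lambda>i. c i * c i)"
    using transpose_udiag[OF u(1)] udiag_mult[OF U] by simp
  have "(kvol k (udiag U c))\<^sup>2 = det (transpose_mat (transpose_mat U * V) * (mat_diag m (\<lambda>i. c i * c i) * (transpose_mat U * V)))"
    unfolding V(3)[symmetric] gram_udiag[OF M U eq V(1)] ..
  also have "\<dots> \<le> (K ^ k)\<^sup>2 * det (transpose_mat (transpose_mat U * V) * (transpose_mat U * V))"
  proof (rule gram_diag_bound)
    show "transpose_mat U * V \<in> carrier_mat m k" using u V by auto
    fix f :: "nat \<Rightarrow> nat" assume f: "f ` {..<k} \<subseteq> {..<m}"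
    have "(\<Prod>i<k. c (f i) * c (f i)) \<le> (\<Prod>i<k. K\<^sup>2)"
    proof (rule prod_mono)
      fix i assume "i \<in> {..<k}"
      then have "\<bar>c (f i)\<bar> \<le> K" using f c by auto
      then have "(c (f i))\<^sup>2 \<le> K\<^sup>2" using K by (simp add: abs_le_square_iff[symmetric])
      then show "0 \<le> c (f i) * c (f i) \<and> c (f i) * c (f i) \<le> K\<^sup>2" by (simp add: power2_eq_square)
    qed
    then show "(\<Prod>i<k. c (f i) * c (f i)) \<le> (K ^ k)\<^sup>2" by (simp add: power_mult[symmetric] mult.commute)
  qed
  also have "\<dots> = (K ^ k)\<^sup>2" unfolding gram_orth[OF U V(1)] V(2) by simp
  finally show ?thesis using K by (auto intro: power2_le_imp_le)
qed

section \<open>Interpolation between the end points\<close>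

text \<open>Dividing by the expected bound \<open>h\<close>, which satisfies both doubling conditions with equality, leads to
  the case \<open>a = b = 1\<close>. There both conditions bound \<open>(g t)\<^sup>2\<close> by a value of \<open>g\<close>, so the supremum \<open>S\<close> of \<open>g\<close>
  satisfies \<open>S \<le> sqrt S\<close>, hence \<open>S \<le> 1\<close>. Boundedness takes the place of the continuity used in
  proofs through midpoint convexity.\<close>

lemma doubling_bootstrap:
  fixes f :: "real \<Rightarrow> real"
  assumes nonneg: "\<And>t. 0 \<le> t \<Longrightarrow> t \<le> 1 \<Longrightarrow> 0 \<le> f t"
    and bounded: "\<And>t. 0 \<le> t \<Longrightarrow> t \<le> 1 \<Longrightarrow> f t \<le> K"
    and a: "0 < a" and b: "0 < b"
    and left: "\<And>t. 0 \<le> t \<Longrightarrow> t \<le> 1 / 2 \<Longrightarrow> (f t)\<^sup>2 \<le> a * f (2 * t)"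
    and right: "\<And>t. 1 / 2 \<le> t \<Longrightarrow> t \<le> 1 \<Longrightarrow> (f t)\<^sup>2 \<le> b * f (2 * t - 1)"
    and t: "0 \<le> t" "t \<le> 1"
  shows "f t \<le> a powr (1 - t) * b powr t"
proof -
  define h where "h t = a powr (1 - t) * b powr t" for t
  define g where "g t = f t / h t" for t
  have h: "0 < h t" for t using a b by (simp add: h_def)
  have h2: "(h t)\<^sup>2 = a * h (2 * t)" "(h t)\<^sup>2 = b * h (2 * t - 1)" for t
  proof -
    have "(h t)\<^sup>2 = (a powr (1 - t) * a powr (1 - t)) * (b powr t * b powr t)"
      by (simp add: h_def power2_eq_square mult_ac)
    also have "\<dots> = a powr (1 - t + (1 - t)) * b powr (t + t)" by (simp only: powr_add)
    finally have e: "(h t)\<^sup>2 = a powr (1 - t + (1 - t)) * b powr (t + t)" .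
    have "a * h (2 * t) = (a powr 1 * a powr (1 - 2 * t)) * b powr (2 * t)" using a by (simp add: h_def)
    also have "\<dots> = a powr (1 + (1 - 2 * t)) * b powr (2 * t)" by (simp only: powr_add)
    finally show "(h t)\<^sup>2 = a * h (2 * t)" unfolding e by (simp add: algebra_simps)
    have "b * h (2 * t - 1) = a powr (1 - (2 * t - 1)) * (b powr 1 * b powr (2 * t - 1))" using b by (simp add: h_def)
    also have "\<dots> = a powr (1 - (2 * t - 1)) * b powr (1 + (2 * t - 1))" by (simp only: powr_add)
    finally show "(h t)\<^sup>2 = b * h (2 * t - 1)" unfolding e by (simp add: algebra_simps)
  qed
  have gn: "0 \<le> g t" if "0 \<le> t" "t \<le> 1" for t using nonneg[OF that] h[of t] by (simp add: g_def)
  have gb: "bdd_above (g ` {0..1})"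
  proof -
    define c where "c = min 1 a * min 1 b"
    have c: "0 < c" using a b by (simp add: c_def)
    have lower: "min 1 x \<le> x powr s" if "0 < x" "0 \<le> s" "s \<le> 1" for x s :: real
    proof (cases "x \<le> 1")
      case True
      then have "x powr 1 \<le> x powr s" using that by (intro powr_mono') auto
      then show ?thesis using that by simp
    next
      case False
      then show ?thesis using that by (simp add: ge_one_powr_ge_zero min_def)
    qed
    have "c \<le> h t" if "0 \<le> t" "t \<le> 1" for t
      unfolding c_def h_def using that a b by (intro mult_mono lower) auto
    then have "g t \<le> K / c" if "0 \<le> t" "t \<le> 1" for t
      unfolding g_def using that bounded[OF that] nonneg[OF that] c by (intro frac_le) auto
    then show ?thesis by (intro bdd_aboveI[of _ "K / c"]) auto
  qed
  define S where "S = Sup (g ` {0..1})"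
  have gS: "g t \<le> S" if "0 \<le> t" "t \<le> 1" for t
    unfolding S_def using that gb by (intro cSup_upper) auto
  have S0: "0 \<le> S" using gS[of 0] gn[of 0] by simp
  have "g t \<le> sqrt S" if t: "0 \<le> t" "t \<le> 1" for t
  proof -
    have "(g t)\<^sup>2 \<le> S"
    proof (cases "t \<le> 1 / 2")
      case True
      have "(g t)\<^sup>2 = (f t)\<^sup>2 / (a * h (2 * t))" by (simp add: g_def power_divide h2(1))
      also have "\<dots> \<le> a * f (2 * t) / (a * h (2 * t))"
        using left[OF t(1) True] a h[of "2 * t"] by (intro divide_right_mono) auto
      also have "\<dots> = g (2 * t)" using a by (simp add: g_def)
      also have "\<dots> \<le> S" using t True by (intro gS) auto
      finally show ?thesis .
    next
      case False
      have "(g t)\<^sup>2 = (f t)\<^sup>2 / (b * h (2 * t - 1))" by (simp add: g_def power_divide h2(2))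
      also have "\<dots> \<le> b * f (2 * t - 1) / (b * h (2 * t - 1))"
        using right[of t] t False b h[of "2 * t - 1"] by (intro divide_right_mono) auto
      also have "\<dots> = g (2 * t - 1)" using b by (simp add: g_def)
      also have "\<dots> \<le> S" using t False by (intro gS) auto
      finally show ?thesis .
    qed
    then show ?thesis by (rule real_le_rsqrt)
  qed
  then have "S \<le> sqrt S" unfolding S_def by (intro cSup_least) auto
  then have "S\<^sup>2 \<le> S" using S0 power_mono[of S "sqrt S" 2] by simp
  then have "S \<le> 1" using S0 by (cases "S = 0") (auto simp: power2_eq_square)
  then have "g t \<le> 1" using gS[OF t] by simp
  then show ?thesis using h[of t] by (simp add: g_def h_def field_simps)
qed

text \<open>The doubling conditions survive an increase of \<open>a\<close> and \<open>b\<close>, so the degenerate cases \<open>a = 0\<close> and \<open>b = 0\<close>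
  follow by a limit. At the end points the bound itself can fail, since \<open>0 powr 0 = 0\<close>.\<close>

lemma doubling_bootstrap_nonneg:
  fixes f :: "real \<Rightarrow> real"
  assumes nonneg: "\<And>t. 0 \<le> t \<Longrightarrow> t \<le> 1 \<Longrightarrow> 0 \<le> f t"
    and bounded: "\<And>t. 0 \<le> t \<Longrightarrow> t \<le> 1 \<Longrightarrow> f t \<le> K"
    and a: "0 \<le> a" and b: "0 \<le> b"
    and left: "\<And>t. 0 \<le> t \<Longrightarrow> t \<le> 1 / 2 \<Longrightarrow> (f t)\<^sup>2 \<le> a * f (2 * t)"
    and right: "\<And>t. 1 / 2 \<le> t \<Longrightarrow> t \<le> 1 \<Longrightarrow> (f t)\<^sup>2 \<le> b * f (2 * t - 1)"
    and t: "0 < t" "t < 1"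
  shows "f t \<le> a powr (1 - t) * b powr t"
proof (rule tendsto_lowerbound)
  have z: "(\<lambda>n. x + 1 / real (Suc n)) \<longlonglongrightarrow> x" for x
    using tendsto_add[OF tendsto_const[of x] LIMSEQ_inverse_real_of_nat] by (simp add: inverse_eq_divide)
  show "(\<lambda>n. (a + 1 / real (Suc n)) powr (1 - t) * (b + 1 / real (Suc n)) powr t)
      \<longlonglongrightarrow> a powr (1 - t) * b powr t"
    using t a b by (intro tendsto_mult tendsto_powr' z tendsto_const) (auto intro!: always_eventually)
  show "\<forall>\<^sub>F n in sequentially. f t \<le> (a + 1 / real (Suc n)) powr (1 - t) * (b + 1 / real (Suc n)) powr t"
  proof (intro always_eventually allI doubling_bootstrap[of f K])
    fix n s
    show "0 < a + 1 / real (Suc n)" "0 < b + 1 / real (Suc n)" using a b by (auto intro: add_nonneg_pos)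
    show "(f s)\<^sup>2 \<le> (a + 1 / real (Suc n)) * f (2 * s)" if "0 \<le> s" "s \<le> 1 / 2"
      using that by (intro order_trans[OF left] mult_right_mono nonneg) auto
    show "(f s)\<^sup>2 \<le> (b + 1 / real (Suc n)) * f (2 * s - 1)" if "1 / 2 \<le> s" "s \<le> 1"
      using that by (intro order_trans[OF right] mult_right_mono nonneg) auto
  qed (use nonneg bounded t in auto)
qed simp

text \<open>The power with the convention \<open>x\<^sup>0 = 1\<close> also for \<open>x = 0\<close>, where \<open>powr\<close> has the value \<open>0\<close>. With it the
  powers of a singular matrix form a semigroup that starts at the identity.\<close>

definition ppow :: "real mat \<Rightarrow> (nat \<Rightarrow> real) \<Rightarrow> real \<Rightarrow> real mat" where
  "ppow U d s = udiag U (\<lambda>i. if s = 0 then 1 else d i powr s)"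

lemma ppow_props:
  assumes U: "orth m U"
  shows "ppow U d s \<in> carrier_mat m m" "transpose_mat (ppow U d s) = ppow U d s"
    "ppow U d 0 = 1\<^sub>m m"
    "0 \<le> s \<Longrightarrow> 0 \<le> t \<Longrightarrow> ppow U d (s + t) = ppow U d s * ppow U d t"
    "(\<And>i. i < m \<Longrightarrow> 0 \<le> d i) \<Longrightarrow> ppow U d 1 = udiag U d"
  using orthD(1)[OF U] udiag_one[OF U] unfolding ppow_def
  by (auto simp: transpose_udiag udiag_mult[OF U] powr_add intro!: udiag_cong[of U m])

lemma kvol_ppow_bounded:
  assumes U: "orth m U" and d: "\<And>i. i < m \<Longrightarrow> 0 \<le> d i" and k: "k \<le> m"
  obtains K where "\<And>s. 0 \<le> s \<Longrightarrow> s \<le> p \<Longrightarrow> kvol k (ppow U d s) \<le> K" "0 \<le> K"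
proof (rule that)
  \<comment> \<open>A common upper bound for the eigenvalues that is at least 1, so that its powers increase.\<close>
  define D where "D = 1 + (\<Sum>i<m. d i)"
  have D: "d i \<le> D" if "i < m" for i
    using member_le_sum[of i "{..<m}" d] that d unfolding D_def by auto
  have D1: "1 \<le> D" unfolding D_def using d by (auto intro!: sum_nonneg)
  show "kvol k (ppow U d s) \<le> (D powr p) ^ k" if s: "0 \<le> s" "s \<le> p" for s
    unfolding ppow_def
  proof (rule kvol_udiag_le[OF U k])
    fix i assume i: "i < m"
    have "d i powr s \<le> D powr s" using d[OF i] D[OF i] s by (intro powr_mono2) auto
    also have "\<dots> \<le> D powr p" using D1 s by (intro powr_mono) auto
    finally show "\<bar>if s = 0 then 1 else d i powr s\<bar> \<le> D powr p"
      using D1 s by (auto intro: ge_one_powr_ge_zero)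
  qed simp
  show "0 \<le> (D powr p) ^ k" by simp
qed

text \<open>Applied with \<open>As\<close>, \<open>A1\<close>, \<open>A2\<close> powers of one matrix. In \<open>M\<^sup>T M = Bt X\<^sup>T As As X Bt\<close> the swap moves the first
  \<open>Bt\<close> to the end, and the middle \<open>As As\<close> is then cut into \<open>A1 A2\<close>.\<close>

lemma kvol_halving_left:
  assumes c: "As \<in> carrier_mat m m" "A1 \<in> carrier_mat m m" "A2 \<in> carrier_mat m m" "X \<in> carrier_mat m m" "Bt \<in> carrier_mat m m"
    and sym: "transpose_mat As = As" "transpose_mat A1 = A1" "transpose_mat Bt = Bt"
    and sq: "As * As = A1 * A2" and k: "k \<le> m"
  shows "(kvol k (As * X * Bt))\<^sup>2 \<le> kvol k (A1 * X) * kvol k (A2 * X * (Bt * Bt))"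
proof -
  have "transpose_mat (As * X * Bt) * (As * X * Bt) = Bt * (transpose_mat X * ((As * As) * (X * Bt)))"
    using c by (simp add: transpose_mult[of _ m m _ m] sym assoc_mult_mat[of _ m m _ m _ m])
  then have "(kvol k (As * X * Bt))\<^sup>2 \<le> kvol k (transpose_mat X * ((As * As) * (X * Bt)) * Bt)"
    using c k by (intro kvol_sq_le_kvol_swap[of _ m]) auto
  also have "transpose_mat X * ((As * As) * (X * Bt)) * Bt = transpose_mat (A1 * X) * (A2 * X * (Bt * Bt))"
    unfolding sq using c by (simp add: transpose_mult[of _ m m _ m] sym assoc_mult_mat[of _ m m _ m _ m])
  also have "kvol k \<dots> \<le> kvol k (transpose_mat (A1 * X)) * kvol k (A2 * X * (Bt * Bt))"
    using c k by (intro kvol_mult_le[of _ m]) auto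
  also have "kvol k (transpose_mat (A1 * X)) = kvol k (A1 * X)"
    using c k by (intro kvol_transpose[of _ m]) auto
  finally show ?thesis .
qed

text \<open>The mirror image of the preceding lemma, by transposition.\<close>

lemma kvol_halving_right:
  assumes c: "As \<in> carrier_mat m m" "X \<in> carrier_mat m m" "Bt \<in> carrier_mat m m" "B1 \<in> carrier_mat m m" "B2 \<in> carrier_mat m m"
    and sym: "transpose_mat As = As" "transpose_mat Bt = Bt" "transpose_mat B1 = B1" "transpose_mat B2 = B2"
    and sq: "Bt * Bt = B1 * B2" and k: "k \<le> m"
  shows "(kvol k (As * X * Bt))\<^sup>2 \<le> kvol k (X * B1) * kvol k ((As * As) * X * B2)"
proof -
  have t: "kvol k (transpose_mat M) = kvol k M" if "M \<in> carrier_mat m m" for M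
    using that k by (rule kvol_transpose)
  have "(kvol k (Bt * transpose_mat X * As))\<^sup>2 \<le> kvol k (B1 * transpose_mat X) * kvol k (B2 * transpose_mat X * (As * As))"
    using c sym sq k by (intro kvol_halving_left[of _ m]) auto
  moreover have "Bt * transpose_mat X * As = transpose_mat (As * X * Bt)"
    "B1 * transpose_mat X = transpose_mat (X * B1)"
    "B2 * transpose_mat X * (As * As) = transpose_mat ((As * As) * X * B2)"
    using c by (simp_all add: transpose_mult[of _ m m _ m] sym assoc_mult_mat[of _ m m _ m _ m])
  ultimately show ?thesis using c by (simp add: t)
qed

text \<open>On the left half of the unit interval the doubled exponent of \<open>B\<close> is split as
  \<open>2 * q * (1 - t) = q + q * (1 - 2 * t)\<close>, so that one factor becomes \<open>X B\<^sup>q\<close> and the other is \<open>f (2 * t)\<close>; on the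
  right half the exponent of \<open>A\<close> is split in the same way.\<close>

lemma kvol_interpolation:
  assumes U: "orth m U" and a: "\<And>i. i < m \<Longrightarrow> 0 \<le> a i"
    and V: "orth m V" and b: "\<And>i. i < m \<Longrightarrow> 0 \<le> b i"
    and X: "X \<in> carrier_mat m m" and k: "k \<le> m"
    and p: "0 < p" and q: "0 < q" and pq: "1 / p + 1 / q = 1"
  shows "kvol k (udiag U a * X * udiag V b)
    \<le> kvol k (ppow U a p * X) powr (1 / p) * kvol k (X * ppow V b q) powr (1 / q)"
proof -
  define f where "f t = kvol k (ppow U a (p * t) * X * ppow V b (q * (1 - t)))" for t
  note u = ppow_props[OF U, where d = a] and v = ppow_props[OF V, where d = b]
  have f0: "0 \<le> f t" for t unfolding f_def using u(1) v(1) X k by (intro kvol_nonneg[of _ m]) auto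
  obtain K where K: "\<And>s. 0 \<le> s \<Longrightarrow> s \<le> p \<Longrightarrow> kvol k (ppow U a s) \<le> K" "0 \<le> K"
    using kvol_ppow_bounded[where d = a, OF U a k] by blast
  obtain L where L: "\<And>s. 0 \<le> s \<Longrightarrow> s \<le> q \<Longrightarrow> kvol k (ppow V b s) \<le> L" "0 \<le> L"
    using kvol_ppow_bounded[where d = b, OF V b k] by blast
  have bound: "f t \<le> K * kvol k X * L" if "0 \<le> t" "t \<le> 1" for t
  proof -
    have "f t \<le> kvol k (ppow U a (p * t)) * kvol k X * kvol k (ppow V b (q * (1 - t)))"
      unfolding f_def using u(1) v(1) X k
      by (intro order_trans[OF kvol_mult_le[of _ m]] mult_right_mono kvol_mult_le[of _ m] kvol_nonneg[of _ m]) auto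
    also have "\<dots> \<le> K * kvol k X * L"
      using that p q K(2) u(1) v(1) X k
      by (intro mult_mono K L mult_nonneg_nonneg kvol_nonneg[of _ m]) (auto simp: mult_le_cancel_left1 mult_le_cancel_left2)
    finally show ?thesis .
  qed
  have left: "(f t)\<^sup>2 \<le> kvol k (X * ppow V b q) * f (2 * t)" if t: "0 \<le> t" "t \<le> 1 / 2" for t
  proof -
    have "ppow V b (q * (1 - t)) * ppow V b (q * (1 - t)) = ppow V b q * ppow V b (q * (1 - 2 * t))"
      using t q by (subst v(4)[symmetric], simp, simp, subst v(4)[symmetric]) (auto simp: algebra_simps)
    then have "(f t)\<^sup>2 \<le> kvol k (X * ppow V b q) *
        kvol k (ppow U a (p * t) * ppow U a (p * t) * X * ppow V b (q * (1 - 2 * t)))"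
      unfolding f_def using u(1,2) v(1,2) X k by (intro kvol_halving_right[of _ m]) auto
    also have "ppow U a (p * t) * ppow U a (p * t) = ppow U a (p * (2 * t))"
      using t p by (subst u(4)[symmetric]) (auto simp: algebra_simps)
    finally show ?thesis by (simp add: f_def)
  qed
  have right: "(f t)\<^sup>2 \<le> kvol k (ppow U a p * X) * f (2 * t - 1)" if t: "1 / 2 \<le> t" "t \<le> 1" for t
  proof -
    have "ppow U a (p * t) * ppow U a (p * t) = ppow U a p * ppow U a (p * (2 * t - 1))"
      using t p by (subst u(4)[symmetric], simp, simp, subst u(4)[symmetric]) (auto simp: algebra_simps)
    then have "(f t)\<^sup>2 \<le> kvol k (ppow U a p * X) *
        kvol k (ppow U a (p * (2 * t - 1)) * X * (ppow V b (q * (1 - t)) * ppow V b (q * (1 - t))))"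
      unfolding f_def using u(1,2) v(1,2) X k by (intro kvol_halving_left[of _ m]) auto
    also have "ppow V b (q * (1 - t)) * ppow V b (q * (1 - t)) = ppow V b (q * (1 - (2 * t - 1)))"
      using t q by (subst v(4)[symmetric]) (auto simp: algebra_simps)
    finally show ?thesis by (simp add: f_def)
  qed
  have "0 < 1 / q" using q by simp
  then have p1: "1 / p < 1" "1 - 1 / p = 1 / q" using pq by linarith+
  have "f (1 / p) \<le> kvol k (X * ppow V b q) powr (1 - 1 / p) * kvol k (ppow U a p * X) powr (1 / p)"
    by (rule doubling_bootstrap_nonneg[OF f0 bound _ _ left right])
       (use p p1 u(1) v(1) X k in \<open>auto intro!: kvol_nonneg[of _ m]\<close>)
  moreover have "f (1 / p) = kvol k (udiag U a * X * udiag V b)"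
    unfolding f_def p1(2) using p q u(5)[OF a] v(5)[OF b] by simp
  ultimately show ?thesis unfolding p1(2) by (simp add: mult.commute)
qed

section \<open>From log-majorisation to sums\<close>

text \<open>Weak log-majorisation implies weak majorisation. Where \<open>x\<close> is positive,
  \<open>y i - x i \<ge> x i * ln (y i / x i)\<close>. The partial sums of \<open>ln (y i / x i)\<close> are nonnegative and the weights \<open>x i\<close>
  decrease, so by summation by parts the sum of the right-hand sides is nonnegative.\<close>

lemma sum_le_of_prod_le:
  fixes x y :: "nat \<Rightarrow> real"
  assumes x: "\<And>i. i < m \<Longrightarrow> 0 \<le> x i" and y: "\<And>i. i < m \<Longrightarrow> 0 \<le> y i"
    and dec: "\<And>i j. i \<le> j \<Longrightarrow> j < m \<Longrightarrow> x j \<le> x i"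
    and prod: "\<And>k. k \<le> m \<Longrightarrow> (\<Prod>i<k. x i) \<le> (\<Prod>i<k. y i)"
  shows "(\<Sum>i<m. x i) \<le> (\<Sum>i<m. y i)"
proof -
  have pos: "(\<Sum>i<l. x i) \<le> (\<Sum>i<l. y i)" if l: "l \<le> m" and xp: "\<And>i. i < l \<Longrightarrow> 0 < x i" for l
  proof -
    have yp: "0 < y i" if "i < l" for i
    proof -
      have "0 < (\<Prod>i<l. x i)" using xp by (intro prod_pos) auto
      also have "\<dots> \<le> (\<Prod>i<l. y i)" using prod l by simp
      finally have "(\<Prod>i<l. y i) \<noteq> 0" by (metis less_irrefl)
      then have "y i \<noteq> 0" using that by auto
      then show ?thesis using y[of i] that l by simp
    qed
    have ne: "x i \<noteq> 0" "y i \<noteq> 0" if "i < l" for i using xp[OF that] yp[OF that] by auto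
    define u where "u i = ln (y i) - ln (x i)" for i
    have partial: "0 \<le> (\<Sum>i<k. u i)" if k: "k \<le> l" for k
    proof -
      have "ln (\<Prod>i<k. x i) \<le> ln (\<Prod>i<k. y i)"
        using prod[of k] k l xp by (intro ln_mono) (auto intro!: prod_pos)
      also have "ln (\<Prod>i<k. y i) = (\<Sum>i<k. ln (y i))" using k by (intro ln_prod ne) auto
      also have "ln (\<Prod>i<k. x i) = (\<Sum>i<k. ln (x i))" using k by (intro ln_prod ne) auto
      finally show ?thesis by (simp add: u_def sum_subtractf)
    qed
    \<comment> \<open>Summation by parts; for \<open>k = 0\<close> the truncated index \<open>k - 1\<close> is harmless, since the sums are empty.\<close>
    have abel: "x (k - 1) * (\<Sum>i<k. u i) \<le> (\<Sum>i<k. x i * u i)" if "k \<le> l" for k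
      using that
    proof (induction k)
      case (Suc k)
      have "x k * (\<Sum>i<k. u i) \<le> x (k - 1) * (\<Sum>i<k. u i)"
        using Suc.prems l by (intro mult_right_mono dec partial) auto
      then show ?case using Suc by (simp add: algebra_simps)
    qed simp
    have "0 \<le> (\<Sum>i<l. x i * u i)"
    proof (cases "l = 0")
      case False
      then have "0 \<le> x (l - 1) * (\<Sum>i<l. u i)" using x[of "l - 1"] l partial by (intro mult_nonneg_nonneg) auto
      then show ?thesis using abel[of l] by simp
    qed simp
    also have "\<dots> \<le> (\<Sum>i<l. y i - x i)"
    proof (rule sum_mono)
      fix i assume "i \<in> {..<l}"
      then have i: "0 < x i" "0 < y i" using xp yp by auto
      have "ln (y i / x i) \<le> y i / x i - 1" using i by (intro ln_le_minus_one) auto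
      moreover have "u i = ln (y i / x i)" unfolding u_def using i by (simp add: ln_div)
      ultimately have "u i \<le> y i / x i - 1" by simp
      then have "x i * u i \<le> x i * (y i / x i - 1)" using i by (intro mult_left_mono) auto
      then show "x i * u i \<le> y i - x i" using i by (simp add: algebra_simps)
    qed
    finally show ?thesis by (simp add: sum_subtractf)
  qed
  \<comment> \<open>The positive entries of \<open>x\<close> are those below the least such \<open>k\<close>.\<close>
  define P where "P k \<longleftrightarrow> k \<le> m \<and> (\<forall>i. k \<le> i \<longrightarrow> i < m \<longrightarrow> x i = 0)" for k
  have "P m" by (simp add: P_def)
  define l where "l = (LEAST k. P k)"
  have Pl: "P l" unfolding l_def using \<open>P m\<close> by (rule LeastI)
  have "0 < x i" if "i < l" for i
  proof (rule ccontr)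
    assume "\<not> 0 < x i"
    have il: "i < m" using that Pl by (simp add: P_def)
    then have "x i = 0" using x[of i] \<open>\<not> 0 < x i\<close> by simp
    then have "x j = 0" if "i \<le> j" "j < m" for j using dec[OF that] x[OF that(2)] by simp
    then have "P i" unfolding P_def using il by simp
    then have "l \<le> i" unfolding l_def by (rule Least_le)
    then show False using that by simp
  qed
  then have "(\<Sum>i<l. x i) \<le> (\<Sum>i<l. y i)" using pos[of l] Pl by (simp add: P_def)
  moreover have "(\<Sum>i<m. x i) = (\<Sum>i<l. x i)"
    using Pl by (intro sum.mono_neutral_right) (auto simp: P_def)
  moreover have "(\<Sum>i<l. y i) \<le> (\<Sum>i<m. y i)"
    using Pl y by (intro sum_mono2) (auto simp: P_def)
  ultimately show ?thesis by simp
qed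

text \<open>The inequality \<open>ln x \<le> x - 1\<close> at \<open>x = u / s\<close> and \<open>x = v / s\<close>, where \<open>s\<close> is the weighted arithmetic mean.\<close>

lemma weighted_am_gm:
  fixes u v :: real
  assumes p: "0 < p" and q: "0 < q" and pq: "1 / p + 1 / q = 1" and u: "0 \<le> u" and v: "0 \<le> v"
  shows "u powr (1 / p) * v powr (1 / q) \<le> u / p + v / q"
proof (cases "u = 0 \<or> v = 0")
  case True
  then show ?thesis using p q u v by auto
next
  case False
  then have u: "0 < u" and v: "0 < v" using u v by auto
  define s where "s = u / p + v / q"
  have s: "0 < s" using u v p q by (simp add: s_def add_pos_pos)
  have "ln u - ln s \<le> u / s - 1" "ln v - ln s \<le> v / s - 1"
    using ln_le_minus_one[of "u / s"] ln_le_minus_one[of "v / s"] u v s by (simp_all add: ln_div)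
  then have "(1 / p) * (ln u - ln s) + (1 / q) * (ln v - ln s) \<le> (1 / p) * (u / s - 1) + (1 / q) * (v / s - 1)"
    using p q by (intro add_mono mult_left_mono) auto
  also have "\<dots> = (u / p + v / q) / s - (1 / p + 1 / q)" by (simp add: algebra_simps add_divide_distrib)
  also have "\<dots> = 0" using s pq by (simp flip: s_def)
  finally have "(1 / p) * ln u + (1 / q) * ln v \<le> (1 / p + 1 / q) * ln s" by (simp add: algebra_simps)
  then have "exp ((1 / p) * ln u + (1 / q) * ln v) \<le> exp (ln s)" unfolding pq by simp
  then show ?thesis using u v s by (simp add: powr_def exp_add s_def)
qed

lemma Hoelder_sum:
  fixes x y :: "'a \<Rightarrow> real"
  assumes p: "0 < p" and q: "0 < q" and pq: "1 / p + 1 / q = 1"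
    and x: "\<And>i. i \<in> I \<Longrightarrow> 0 \<le> x i" and y: "\<And>i. i \<in> I \<Longrightarrow> 0 \<le> y i" and I: "finite I"
  shows "(\<Sum>i\<in>I. x i powr (1 / p) * y i powr (1 / q)) \<le> (\<Sum>i\<in>I. x i) powr (1 / p) * (\<Sum>i\<in>I. y i) powr (1 / q)"
proof -
  define S T where "S = (\<Sum>i\<in>I. x i)" and "T = (\<Sum>i\<in>I. y i)"
  have S: "0 \<le> S" and T: "0 \<le> T" using x y by (auto simp: S_def T_def intro: sum_nonneg)
  show ?thesis
  proof (cases "S = 0 \<or> T = 0")
    case True
    then have "x i = 0 \<or> y i = 0" if "i \<in> I" for i
      using that I x y unfolding S_def T_def by (auto simp: sum_nonneg_eq_0_iff)
    then have "(\<Sum>i\<in>I. x i powr (1 / p) * y i powr (1 / q)) = 0"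
      by (intro sum.neutral) auto
    then show ?thesis by simp
  next
    case False
    then have S: "0 < S" and T: "0 < T" using S T by auto
    have "x i powr (1 / p) * y i powr (1 / q) \<le> (S powr (1 / p) * T powr (1 / q)) * (x i / S / p + y i / T / q)" if i: "i \<in> I" for i
    proof -
      \<comment> \<open>The weighted inequality of arithmetic and geometric means, after normalising both sums to 1.\<close>
      have "(x i / S) powr (1 / p) * (y i / T) powr (1 / q) \<le> x i / S / p + y i / T / q"
        using x[OF i] y[OF i] S T by (intro weighted_am_gm[OF p q pq]) auto
      then have "(S powr (1 / p) * T powr (1 / q)) * ((x i / S) powr (1 / p) * (y i / T) powr (1 / q))
        \<le> (S powr (1 / p) * T powr (1 / q)) * (x i / S / p + y i / T / q)"
        by (intro mult_left_mono) auto
      then show ?thesis using x[OF i] y[OF i] S T by (simp add: powr_divide)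
    qed
    then have "(\<Sum>i\<in>I. x i powr (1 / p) * y i powr (1 / q))
      \<le> (\<Sum>i\<in>I. (S powr (1 / p) * T powr (1 / q)) * (x i / S / p + y i / T / q))" by (rule sum_mono)
    also have "\<dots> = (S powr (1 / p) * T powr (1 / q)) * (S / S / p + T / T / q)"
      unfolding sum_distrib_left[symmetric] sum.distrib sum_divide_distrib[symmetric] S_def T_def ..
    also have "\<dots> = S powr (1 / p) * T powr (1 / q)" using S T pq by simp
    finally show ?thesis by (simp add: S_def T_def)
  qed
qed

text \<open>A Hoelder inequality for the sums of \<open>r\<close>-th powers of singular values. It includes the exponents
  \<open>r < 1\<close>, for which these sums do not come from a norm.\<close>

lemma schatten_interpolation:
  assumes U: "orth m U" and a: "\<And>i. i < m \<Longrightarrow> 0 \<le> a i"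
    and V: "orth m V" and b: "\<And>i. i < m \<Longrightarrow> 0 \<le> b i"
    and X: "X \<in> carrier_mat m m"
    and p: "0 < p" and q: "0 < q" and pq: "1 / p + 1 / q = 1" and r: "0 < r"
  shows "(\<Sum>i<m. svals (udiag U a * X * udiag V b) i powr r)
    \<le> (\<Sum>i<m. svals (ppow U a p * X) i powr r) powr (1 / p) * (\<Sum>i<m. svals (X * ppow V b q) i powr r) powr (1 / q)"
proof -
  define Y P Q where "Y = udiag U a * X * udiag V b" and "P = ppow U a p * X" and "Q = X * ppow V b q"
  have c: "Y \<in> carrier_mat m m" "P \<in> carrier_mat m m" "Q \<in> carrier_mat m m"
    unfolding Y_def P_def Q_def using orthD(1)[OF U] orthD(1)[OF V] ppow_props(1)[OF U] ppow_props(1)[OF V] X by auto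
  have "(\<Sum>i<m. svals Y i powr r) \<le> (\<Sum>i<m. (svals P i powr r) powr (1 / p) * (svals Q i powr r) powr (1 / q))"
  proof (rule sum_le_of_prod_le)
    show "svals Y j powr r \<le> svals Y i powr r" if "i \<le> j" "j < m" for i j
      using that svals_props[OF c(1)] r by (intro powr_mono2) auto
    fix k assume k: "k \<le> m"
    have "kvol k Y \<le> kvol k P powr (1 / p) * kvol k Q powr (1 / q)"
      unfolding Y_def P_def Q_def by (rule kvol_interpolation[where a = a and b = b, OF U a V b X k p q pq])
    then have "kvol k Y powr r \<le> (kvol k P powr (1 / p) * kvol k Q powr (1 / q)) powr r"
      using kvol_nonneg[OF c(1) k] r by (intro powr_mono2) auto
    also have "\<dots> = (kvol k P powr r) powr (1 / p) * (kvol k Q powr r) powr (1 / q)"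
      by (simp add: powr_mult powr_powr mult.commute)
    finally show "(\<Prod>i<k. svals Y i powr r) \<le> (\<Prod>i<k. (svals P i powr r) powr (1 / p) * (svals Q i powr r) powr (1 / q))"
      by (simp add: kvol_def prod_powr_distrib prod.distrib)
  qed auto
  also have "\<dots> \<le> (\<Sum>i<m. svals P i powr r) powr (1 / p) * (\<Sum>i<m. svals Q i powr r) powr (1 / q)"
    by (rule Hoelder_sum[OF p q pq]) auto
  finally show ?thesis unfolding Y_def P_def Q_def .
qed

section \<open>Block circulant matrices\<close>

text \<open>Invariance under the simultaneous cyclic shift of block rows and block columns. It says
  that the matrix commutes with a permutation, and in this form it passes to products and to functions of
  the matrix.\<close>

definition shift_inv :: "nat \<Rightarrow> nat \<Rightarrow> real mat \<Rightarrow> bool" where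
  "shift_inv n n3 M \<longleftrightarrow> M \<in> carrier_mat (n * n3) (n * n3) \<and>
     (\<forall>i < n * n3. \<forall>j < n * n3. M $$ ((i + n) mod (n * n3), (j + n) mod (n * n3)) = M $$ (i, j))"

lemma bcirc_carrier:
  assumes "A \<in> tensors n1 n2 n3" "0 < n3"
  shows "bcirc A \<in> carrier_mat (n1 * n3) (n2 * n3)"
  using tensors_dims[OF assms] by (simp add: bcirc_def Let_def)

lemma bcirc_index:
  assumes "A \<in> tensors n1 n2 n3" "0 < n3" "i < n1 * n3" "j < n2 * n3"
  shows "bcirc A $$ (i, j) = A ! ((i div n1 + n3 - j div n2) mod n3) $$ (i mod n1, j mod n2)"
  using tensors_dims[OF assms(1,2)] assms(3,4) by (simp add: bcirc_def Let_def)

lemma bcirc_inj: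
  assumes A: "A \<in> tensors n1 n2 n3" and B: "B \<in> tensors n1 n2 n3" and n3: "0 < n3" and eq: "bcirc A = bcirc B"
  shows "A = B"
proof -
  have "tunfold A = tunfold B"
    unfolding tunfold_def tensors_dims[OF A n3] tensors_dims[OF B n3] eq ..
  then show ?thesis using tfold_tunfold[OF A n3] tfold_tunfold[OF B n3] by metis
qed

lemma mod_diff_shift:
  fixes a b N :: nat
  assumes "a < N" "b < N"
  shows "((a + 1) mod N + N - (b + 1) mod N) mod N = (a + N - b) mod N"
proof (cases "a + 1 = N"; cases "b + 1 = N")
  assume "a + 1 = N" "b + 1 \<noteq> N"
  then show ?thesis using assms by (simp add: le_mod_geq)
next
  assume "a + 1 \<noteq> N" "b + 1 = N"
  then have "b = N - 1" by simp
  then show ?thesis using assms by (simp add: le_mod_geq)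
next
  assume "a + 1 \<noteq> N" "b + 1 \<noteq> N"
  then show ?thesis using assms by simp
qed (use assms in auto)

lemma shift_inv_bcirc:
  assumes A: "A \<in> tensors n n n3" and n: "0 < n" "0 < n3"
  shows "shift_inv n n3 (bcirc A)"
  unfolding shift_inv_def
proof (intro conjI allI impI)
  fix i j assume ij: "i < n * n3" "j < n * n3"
  have N: "0 < n * n3" using n by simp
  have dm: "(l + n) mod (n * n3) div n = (l div n + 1) mod n3" "(l + n) mod (n * n3) mod n = l mod n" for l
    using n by (simp_all add: mod_mult2_eq)
  have "i div n < n3" "j div n < n3" using ij n by (simp_all add: less_mult_imp_div_less mult.commute)
  from mod_diff_shift[OF this]
  show "bcirc A $$ ((i + n) mod (n * n3), (j + n) mod (n * n3)) = bcirc A $$ (i, j)"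
    using N ij by (simp add: bcirc_index[OF A n(2)] dm)
qed (rule bcirc_carrier[OF A n(2)])

lemma shift_inv_iterate:
  assumes M: "shift_inv n n3 M" and ij: "i < n * n3" "j < n * n3"
  shows "M $$ ((i + n * t) mod (n * n3), (j + n * t) mod (n * n3)) = M $$ (i, j)"
proof (induction t)
  case 0
  then show ?case using ij by simp
next
  case (Suc t)
  have N: "0 < n * n3" using ij by linarith
  have s: "(l + n * Suc t) mod (n * n3) = ((l + n * t) mod (n * n3) + n) mod (n * n3)" for l
    by (simp add: mod_simps algebra_simps)
  show ?case unfolding s using M N Suc unfolding shift_inv_def by simp
qed

text \<open>The tensor is read off the first block column. Shifting \<open>t\<close> times moves the block column of an entry
  to the first one.\<close>

lemma shift_inv_imp_bcirc:
  assumes M: "shift_inv n n3 M" and n: "0 < n" "0 < n3"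
  obtains B where "B \<in> tensors n n n3" "bcirc B = M"
proof -
  define B where "B = map (\<lambda>k. mat n n (\<lambda>(i, j). M $$ (k * n + i, j))) [0..<n3]"
  have B: "B \<in> tensors n n n3" by (auto simp: B_def tensors_def)
  have Mc: "M \<in> carrier_mat (n * n3) (n * n3)" using M by (simp add: shift_inv_def)
  have "bcirc B = M"
  proof (intro eq_matI)
    fix i j assume "i < dim_row M" "j < dim_col M"
    then have ij: "i < n * n3" "j < n * n3" using Mc by auto
    have b: "j div n < n3" using ij n by (simp add: less_mult_imp_div_less mult.commute)
    define t where "t = n3 - j div n"
    define c where "c = (i div n + n3 - j div n) mod n3"
    have c: "c < n3" using n by (simp add: c_def)
    have "bcirc B $$ (i, j) = B ! c $$ (i mod n, j mod n)"
      unfolding c_def by (rule bcirc_index[OF B n(2) ij])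
    also have "\<dots> = M $$ (c * n + i mod n, j mod n)" using c n by (simp add: B_def)
    also have "c * n + i mod n = (i + n * t) mod (n * n3)"
    proof -
      have "i div n + n3 - j div n = i div n + t" using b by (simp add: t_def)
      then show ?thesis using n by (simp add: mod_mult2_eq c_def add.commute)
    qed
    also have "j mod n = (j + n * t) mod (n * n3)"
      using b n by (simp add: mod_mult2_eq t_def)
    also have "M $$ ((i + n * t) mod (n * n3), (j + n * t) mod (n * n3)) = M $$ (i, j)"
      by (rule shift_inv_iterate[OF M ij])
    finally show "bcirc B $$ (i, j) = M $$ (i, j)" .
  qed (use Mc bcirc_carrier[OF B n(2)] in auto)
  then show ?thesis using that B by blast
qed

lemma rotation_bij:
  fixes c N :: nat
  assumes "c \<le> N" "0 < N"
  shows "bij_betw (\<lambda>a. (a + c) mod N) {..<N} {..<N}"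
proof (rule bij_betw_byWitness[of _ "\<lambda>a. (a + (N - c)) mod N"])
  have "((a + b) mod N + (N - b)) mod N = a" if "a < N" "b \<le> N" for a b
  proof -
    have "((a + b) mod N + (N - b)) mod N = (a + b + (N - b)) mod N" by (rule mod_add_left_eq)
    also have "a + b + (N - b) = a + N" using that by simp
    finally show ?thesis using that by simp
  qed
  from this[of _ c] this[of _ "N - c"] assms
  show "\<forall>a\<in>{..<N}. ((a + c) mod N + (N - c)) mod N = a" "\<forall>a\<in>{..<N}. ((a + (N - c)) mod N + c) mod N = a"
    by auto
qed (use assms in auto)

lemma shift_bij:
  fixes n n3 :: nat
  assumes "0 < n" "0 < n3"
  shows "bij_betw (\<lambda>i. (i + n) mod (n * n3)) {..<n * n3} {..<n * n3}"
  using assms by (intro rotation_bij) auto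

lemma shift_inv_mult:
  assumes M: "shift_inv n n3 M" and L: "shift_inv n n3 L" and n: "0 < n" "0 < n3"
  shows "shift_inv n n3 (M * L)"
  unfolding shift_inv_def
proof (intro conjI allI impI)
  let ?N = "n * n3"
  let ?s = "\<lambda>i. (i + n) mod ?N"
  have c: "M \<in> carrier_mat ?N ?N" "L \<in> carrier_mat ?N ?N" using M L by (auto simp: shift_inv_def)
  then show "M * L \<in> carrier_mat ?N ?N" by simp
  fix i j assume ij: "i < ?N" "j < ?N"
  have s: "?s l < ?N" for l using n by simp
  have idx: "(M * L) $$ (i, j) = (\<Sum>l<?N. M $$ (i, l) * L $$ (l, j))" if "i < ?N" "j < ?N" for i j
    using that c by (simp add: scalar_prod_def atLeast0LessThan)
  have "(M * L) $$ (?s i, ?s j) = (\<Sum>l<?N. M $$ (?s i, l) * L $$ (l, ?s j))" by (rule idx[OF s s])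
  also have "\<dots> = (\<Sum>l<?N. M $$ (?s i, ?s l) * L $$ (?s l, ?s j))"
    by (rule sum.reindex_bij_betw[OF shift_bij[OF n], symmetric])
  also have "\<dots> = (\<Sum>l<?N. M $$ (i, l) * L $$ (l, j))"
    using M L ij unfolding shift_inv_def by (intro sum.cong) auto
  finally show "(M * L) $$ (?s i, ?s j) = (M * L) $$ (i, j)" by (simp only: idx[OF ij])
qed

text \<open>The product of two block circulant matrices is block circulant, and the first block column of
  \<open>bcirc A * bcirc B\<close> is \<open>bcirc A\<close> times that of \<open>bcirc B\<close>, which is how the t-product is defined.\<close>

lemma bcirc_tprod:
  assumes A: "A \<in> tensors n n n3" and B: "B \<in> tensors n n n3" and n: "0 < n" "0 < n3"
  shows "A *\<^sub>t B \<in> tensors n n n3" "bcirc (A *\<^sub>t B) = bcirc A * bcirc B"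
proof -
  obtain C where C: "C \<in> tensors n n n3" "bcirc C = bcirc A * bcirc B"
    using shift_inv_imp_bcirc[OF shift_inv_mult[OF shift_inv_bcirc[OF A n] shift_inv_bcirc[OF B n] n] n] by blast
  note dims = tensors_dims[OF A n(2)] tensors_dims[OF B n(2)] tensors_dims[OF C(1) n(2)]
  have le: "n \<le> n * n3" using n by simp
  have lt: "j < n * n3" if "j < n" for j using that le by linarith
  have "tunfold C = bcirc A * tunfold B"
    using bcirc_carrier[OF A n(2)] bcirc_carrier[OF B n(2)]
    by (intro eq_matI) (auto simp: tunfold_def dims C(2) scalar_prod_def lt)
  then have "A *\<^sub>t B = C" using tfold_tunfold[OF C(1) n(2)] by (simp add: tprod_def dims)
  then show "A *\<^sub>t B \<in> tensors n n n3" "bcirc (A *\<^sub>t B) = bcirc A * bcirc B" using C by auto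
qed

lemma ttranspose_nth:
  assumes "k < length A"
  shows "ttranspose A ! k = transpose_mat (A ! ((length A - k) mod length A))"
proof (cases A)
  case (Cons S Ss)
  then show ?thesis using assms by (cases k) (auto simp: ttranspose_def rev_nth nth_Cons' Suc_diff_Suc)
qed (use assms in simp)

lemma mod_diff_reflect:
  fixes a b N :: nat
  assumes "a < N" "b < N"
  shows "(N - (a + N - b) mod N) mod N = (b + N - a) mod N"
proof (cases a b rule: linorder_cases)
  case less
  then show ?thesis using assms by (simp add: le_mod_geq)
next
  case greater
  then show ?thesis using assms by (simp add: le_mod_geq)
qed (use assms in simp)

lemma bcirc_ttranspose:
  assumes A: "A \<in> tensors n n n3" and n: "0 < n" "0 < n3"
  shows "ttranspose A \<in> tensors n n n3" "bcirc (ttranspose A) = transpose_mat (bcirc A)"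
proof -
  have len: "length A = n3" using A by (simp add: tensors_def)
  have lenT: "length (ttranspose A) = n3" using len by (cases A) (auto simp: ttranspose_def)
  have nth: "ttranspose A ! k = transpose_mat (A ! ((n3 - k) mod n3))" if "k < n3" for k
    using ttranspose_nth[of k A] that len by simp
  show T: "ttranspose A \<in> tensors n n n3"
    unfolding tensors_def using lenT nth tensors_nth[OF A] n by (auto simp: in_set_conv_nth)
  show "bcirc (ttranspose A) = transpose_mat (bcirc A)"
  proof (intro eq_matI)
    fix i j assume "i < dim_row (transpose_mat (bcirc A))" "j < dim_col (transpose_mat (bcirc A))"
    then have ij: "i < n * n3" "j < n * n3" using bcirc_carrier[OF A n(2)] by auto
    have d: "i div n < n3" "j div n < n3" using ij n by (simp_all add: less_mult_imp_div_less mult.commute)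
    have "A ! ((j div n + n3 - i div n) mod n3) \<in> carrier_mat n n" using n by (intro tensors_nth[OF A]) simp
    then show "bcirc (ttranspose A) $$ (i, j) = transpose_mat (bcirc A) $$ (i, j)"
      using ij bcirc_carrier[OF A n(2)] n
      by (simp add: bcirc_index[OF T n(2) ij] bcirc_index[OF A n(2)] nth mod_diff_reflect[OF d])
  qed (use bcirc_carrier[OF A n(2)] bcirc_carrier[OF T n(2)] in auto)
qed

section \<open>Powers of tensors\<close>

text \<open>Well-definedness of the functional calculus. With \<open>W = U\<^sup>T V\<close>, equality of the two matrices means
  \<open>d i * W (i, j) = W (i, j) * e j\<close>. So \<open>d i = e j\<close> wherever \<open>W (i, j) \<noteq> 0\<close>, and the same relation holds after
  applying \<open>\<phi>\<close>.\<close>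

lemma udiag_functional_calculus:
  assumes U: "orth m U" and V: "orth m V" and eq: "udiag U d = udiag V e"
  shows "udiag U (\<lambda>i. \<phi> (d i)) = udiag V (\<lambda>i. \<phi> (e i))"
proof -
  note u = orthD[OF U] and v = orthD[OF V]
  have [simp]: "dim_row U = m" "dim_row V = m" using u v by auto
  define W where "W = transpose_mat U * V"
  have W: "W \<in> carrier_mat m m" using u v by (simp add: W_def)
  have conj: "transpose_mat U * udiag U g = mat_diag m g * transpose_mat U" for g
  proof -
    have "transpose_mat U * udiag U g = (transpose_mat U * U) * (mat_diag m g * transpose_mat U)"
      unfolding udiag_def using u(1) by (simp add: assoc_mult_mat[of _ m m _ m _ m])
    then show ?thesis unfolding u(2) using u(1) by (simp add: left_mult_one_mat[of _ m m])
  qed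
  have "mat_diag m d * W = transpose_mat U * udiag U d * V"
    unfolding conj W_def using u v by (simp add: assoc_mult_mat[of _ m m _ m _ m])
  also have "\<dots> = W * mat_diag m e"
    unfolding eq using u v by (simp add: assoc_mult_mat[of _ m m _ m _ m] udiag_mult_right[OF V] W_def)
  finally have comm: "mat_diag m d * W = W * mat_diag m e" .
  have "mat_diag m (\<lambda>i. \<phi> (d i)) * W = W * mat_diag m (\<lambda>i. \<phi> (e i))"
  proof (intro eq_matI)
    fix i j assume "i < dim_row (W * mat_diag m (\<lambda>i. \<phi> (e i)))" "j < dim_col (W * mat_diag m (\<lambda>i. \<phi> (e i)))"
    then have ij: "i < m" "j < m" using W by (auto simp: mat_diag_def)
    have "d i * W $$ (i, j) = W $$ (i, j) * e j"
      using arg_cong[OF comm, of "\<lambda>M. M $$ (i, j)"] ij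
      by (simp add: mat_diag_mult_left[OF W] mat_diag_mult_right[OF W])
    then have "\<phi> (d i) * W $$ (i, j) = W $$ (i, j) * \<phi> (e j)" by (cases "W $$ (i, j) = 0") auto
    then show "(mat_diag m (\<lambda>i. \<phi> (d i)) * W) $$ (i, j) = (W * mat_diag m (\<lambda>i. \<phi> (e i))) $$ (i, j)"
      using ij by (simp add: mat_diag_mult_left[OF W] mat_diag_mult_right[OF W])
  qed (use W in \<open>auto simp: mat_diag_def\<close>)
  then have "U * (mat_diag m (\<lambda>i. \<phi> (d i)) * W) * transpose_mat V = U * (W * mat_diag m (\<lambda>i. \<phi> (e i))) * transpose_mat V"
    by simp
  moreover have "U * (mat_diag m g * W) * transpose_mat V = udiag U g" for g
  proof -
    have "U * (mat_diag m g * W) * transpose_mat V = U * mat_diag m g * transpose_mat U * (V * transpose_mat V)"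
      unfolding W_def using u(1) v(1) by (simp add: assoc_mult_mat[of _ m m _ m _ m])
    then show ?thesis unfolding v(3) udiag_def using u(1) by (simp add: right_mult_one_mat[of _ m m])
  qed
  moreover have "U * (W * mat_diag m g) * transpose_mat V = udiag V g" for g
  proof -
    have "U * (W * mat_diag m g) * transpose_mat V = (U * transpose_mat U) * (V * mat_diag m g * transpose_mat V)"
      unfolding W_def using u(1) v(1) by (simp add: assoc_mult_mat[of _ m m _ m _ m])
    then show ?thesis unfolding u(3) udiag_def using v(1) by (simp add: left_mult_one_mat[of _ m m])
  qed
  ultimately show ?thesis by simp
qed

lemma psd_mat_powr_udiag:
  assumes U: "orth m U" and d: "\<And>i. i < m \<Longrightarrow> 0 \<le> d i"
  shows "psd_mat_powr (udiag U d) r = udiag U (\<lambda>i. d i powr r)"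
proof -
  have [simp]: "dim_row U = m" using orthD(1)[OF U] by simp
  show ?thesis
    unfolding psd_mat_powr_def Let_def
  proof (rule the_equality)
    show "\<exists>V e. V \<in> carrier_mat (dim_row (udiag U d)) (dim_row (udiag U d)) \<and>
        transpose_mat V * V = 1\<^sub>m (dim_row (udiag U d)) \<and> (\<forall>i<dim_row (udiag U d). 0 \<le> e i) \<and>
        udiag U d = V * mat_diag (dim_row (udiag U d)) e * transpose_mat V \<and>
        udiag U (\<lambda>i. d i powr r) = V * mat_diag (dim_row (udiag U d)) (\<lambda>i. e i powr r) * transpose_mat V"
      using U d by (intro exI[of _ U] exI[of _ d]) (simp add: orth_def udiag_def)
    fix N
    assume "\<exists>V e. V \<in> carrier_mat (dim_row (udiag U d)) (dim_row (udiag U d)) \<and>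
        transpose_mat V * V = 1\<^sub>m (dim_row (udiag U d)) \<and> (\<forall>i<dim_row (udiag U d). 0 \<le> e i) \<and>
        udiag U d = V * mat_diag (dim_row (udiag U d)) e * transpose_mat V \<and>
        N = V * mat_diag (dim_row (udiag U d)) (\<lambda>i. e i powr r) * transpose_mat V"
    then obtain V e where V: "orth m V" and eq: "udiag U d = udiag V e" and N: "N = udiag V (\<lambda>i. e i powr r)"
      by (auto simp: orth_def udiag_def)
    show "N = udiag U (\<lambda>i. d i powr r)"
      unfolding N by (rule udiag_functional_calculus[OF U V eq, of "\<lambda>x. x powr r", symmetric])
  qed
qed

text \<open>Shifting the rows of \<open>U\<close> gives another orthogonal diagonalisation \<open>V\<close> of the same invariant matrix; as the
  functional calculus does not depend on the diagonalisation, its value is invariant too.\<close>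

lemma shift_inv_udiag:
  assumes U: "orth (n * n3) U" and inv: "shift_inv n n3 (udiag U d)" and n: "0 < n" "0 < n3"
  shows "shift_inv n n3 (udiag U (\<lambda>i. \<phi> (d i)))"
proof -
  let ?N = "n * n3"
  let ?s = "\<lambda>i. (i + n) mod ?N"
  note u = orthD[OF U]
  have s: "?s i < ?N" for i using n by simp
  define V where "V = mat ?N ?N (\<lambda>(i, j). U $$ (?s i, j))"
  have V: "V \<in> carrier_mat ?N ?N" by (simp add: V_def)
  have Vidx: "udiag V e $$ (i, j) = udiag U e $$ (?s i, ?s j)" if "i < ?N" "j < ?N" for e i j
    unfolding udiag_index[OF V that] udiag_index[OF u(1) s s] using that by (simp add: V_def)
  have "transpose_mat V * V = 1\<^sub>m ?N"
  proof (intro eq_matI)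
    fix i j assume "i < dim_row (1\<^sub>m ?N)" "j < dim_col (1\<^sub>m ?N)"
    then have ij: "i < ?N" "j < ?N" by auto
    have "(transpose_mat V * V) $$ (i, j) = (\<Sum>l<?N. U $$ (?s l, i) * U $$ (?s l, j))"
      using ij V by (simp add: scalar_prod_def atLeast0LessThan V_def)
    also have "\<dots> = (\<Sum>l<?N. U $$ (l, i) * U $$ (l, j))"
      by (rule sum.reindex_bij_betw[OF shift_bij[OF n]])
    also have "\<dots> = (transpose_mat U * U) $$ (i, j)"
      using ij u(1) by (simp add: scalar_prod_def atLeast0LessThan)
    finally show "(transpose_mat V * V) $$ (i, j) = 1\<^sub>m ?N $$ (i, j)" unfolding u(2) .
  qed (auto simp: V_def)
  then have oV: "orth ?N V" using V by (simp add: orth_def)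
  have "udiag V d = udiag U d"
    using inv V u(1) by (intro eq_matI) (auto simp: Vidx shift_inv_def)
  from udiag_functional_calculus[OF oV U this, of \<phi>]
  have "udiag V (\<lambda>i. \<phi> (d i)) = udiag U (\<lambda>i. \<phi> (d i))" .
  then show ?thesis unfolding shift_inv_def using u(1) Vidx[of _ _ "\<lambda>i. \<phi> (d i)"] by simp
qed

lemma bcirc_tpowr:
  assumes A: "A \<in> tensors n n n3" and n: "0 < n" "0 < n3"
    and U: "orth (n * n3) U" and d: "\<And>i. i < n * n3 \<Longrightarrow> 0 \<le> d i" and eq: "bcirc A = udiag U d"
  shows "tpowr A r \<in> tensors n n n3" "bcirc (tpowr A r) = udiag U (\<lambda>i. d i powr r)"
proof -
  have "shift_inv n n3 (udiag U (\<lambda>i. d i powr r))"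
    by (rule shift_inv_udiag[OF U _ n, of d "\<lambda>x. x powr r"]) (use shift_inv_bcirc[OF A n] eq in simp)
  then obtain B where B: "B \<in> tensors n n n3" "bcirc B = udiag U (\<lambda>i. d i powr r)"
    using shift_inv_imp_bcirc[OF _ n] by blast
  have psd: "psd_mat_powr (bcirc A) r = udiag U (\<lambda>i. d i powr r)"
    unfolding eq by (rule psd_mat_powr_udiag[OF U d])
  have "tpowr A r = B"
    unfolding tpowr_def tensors_dims[OF A n(2)] psd
    using B by (intro the_equality) (auto intro: bcirc_inj[OF _ _ n(2)])
  then show "tpowr A r \<in> tensors n n n3" "bcirc (tpowr A r) = udiag U (\<lambda>i. d i powr r)" using B by auto
qed

lemma bcirc_tabs_powr:
  assumes C: "C \<in> tensors n n n3" and n: "0 < n" "0 < n3"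
  obtains U where "orth (n * n3) U" "tpowr (tabs C) r \<in> tensors n n n3"
    "bcirc (tpowr (tabs C) r) = udiag U (\<lambda>i. svals (bcirc C) i powr r)"
proof -
  let ?N = "n * n3"
  let ?s = "svals (bcirc C)"
  have M: "bcirc C \<in> carrier_mat ?N ?N" by (rule bcirc_carrier[OF C n(2)])
  obtain U where "svd ?N (bcirc C) U ?s" using svd_exists[OF M] .
  then have U: "orth ?N U" and eq: "transpose_mat (bcirc C) * bcirc C = udiag U (\<lambda>i. (?s i)\<^sup>2)"
    and s: "\<And>i. i < ?N \<Longrightarrow> 0 \<le> ?s i" by (auto simp: svd_def)
  note T = bcirc_ttranspose[OF C n]
  note P = bcirc_tprod[OF T(1) C n]
  have "bcirc (ttranspose C *\<^sub>t C) = udiag U (\<lambda>i. (?s i)\<^sup>2)" unfolding P(2) T(2) by (rule eq)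
  from bcirc_tpowr[OF P(1) n U _ this, of "1 / 2"]
  have abs: "tabs C \<in> tensors n n n3" "bcirc (tabs C) = udiag U (\<lambda>i. ((?s i)\<^sup>2) powr (1 / 2))"
    unfolding tabs_def by auto
  have "udiag U (\<lambda>i. ((?s i)\<^sup>2) powr (1 / 2)) = udiag U ?s"
    using s orthD(1)[OF U] by (intro udiag_cong) (auto simp: powr_half_sqrt)
  then have "bcirc (tabs C) = udiag U ?s" using abs(2) by simp
  from bcirc_tpowr[OF abs(1) n U s this, of r] show ?thesis using that U by blast
qed

section \<open>Norms of tensors\<close>

lemma sum_split_blocks:
  fixes h :: "nat \<Rightarrow> real"
  shows "(\<Sum>i<n * n3. h i) = (\<Sum>a<n3. \<Sum>i<n. h (a * n + i))"
proof -
  have "(\<Sum>i<n * n3. h i) = (\<Sum>a<n3. sum h {a * n..<a * n + n})"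
    using sum.nat_group[of h n n3] by (simp add: mult.commute)
  moreover have "sum h {a * n..<a * n + n} = (\<Sum>i<n. h (a * n + i))" for a
    using sum.shift_bounds_nat_ivl[of h 0 "a * n" n] by (simp add: atLeast0LessThan add.commute)
  ultimately show ?thesis by simp
qed

lemma cyclic_difference_bij:
  assumes "b < N"
  shows "bij_betw (\<lambda>a. (a + N - b) mod N) {..<N} {..<N :: nat}"
  using rotation_bij[of "N - b" N] assms by simp

text \<open>Each frontal slice occurs exactly once in every block column, hence \<open>n3\<close> times in \<open>bcirc A\<close>.\<close>

lemma tnorm_F_bcirc:
  assumes A: "A \<in> tensors n n n3" and n: "0 < n" "0 < n3"
  shows "tnorm_F A = sqrt ((\<Sum>i<n * n3. \<Sum>j<n * n3. (bcirc A $$ (i, j))\<^sup>2) / real n3)"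
proof -
  define F where "F = (\<lambda>k. \<Sum>i<n. \<Sum>j<n. (A ! k $$ (i, j))\<^sup>2)"
  have lt: "a * n + i < n * n3" if "a < n3" "i < n" for a i
  proof -
    have "a * n + i < Suc a * n" using that by simp
    also have "\<dots> \<le> n3 * n" using that by (intro mult_right_mono) auto
    finally show ?thesis by (simp add: mult.commute)
  qed
  have "(\<Sum>i<n * n3. \<Sum>j<n * n3. (bcirc A $$ (i, j))\<^sup>2)
    = (\<Sum>a<n3. \<Sum>i<n. \<Sum>b<n3. \<Sum>j<n. (bcirc A $$ (a * n + i, b * n + j))\<^sup>2)"
    unfolding sum_split_blocks ..
  also have "\<dots> = (\<Sum>a<n3. \<Sum>i<n. \<Sum>b<n3. \<Sum>j<n. (A ! ((a + n3 - b) mod n3) $$ (i, j))\<^sup>2)"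
    by (intro sum.cong refl) (simp add: bcirc_index[OF A n(2)] lt)
  also have "\<dots> = (\<Sum>a<n3. \<Sum>b<n3. F ((a + n3 - b) mod n3))"
    unfolding F_def by (rule sum.cong[OF refl], rule sum.swap)
  also have "\<dots> = (\<Sum>b<n3. \<Sum>a<n3. F ((a + n3 - b) mod n3))" by (rule sum.swap)
  also have "\<dots> = (\<Sum>b<n3. \<Sum>k<n3. F k)"
    using sum.reindex_bij_betw[OF cyclic_difference_bij, of _ n3 F] by (rule sum.cong[OF refl]) simp
  also have "\<dots> = real n3 * (\<Sum>k<n3. F k)" by simp
  finally have eq: "(\<Sum>i<n * n3. \<Sum>j<n * n3. (bcirc A $$ (i, j))\<^sup>2) = real n3 * (\<Sum>k<n3. F k)" .
  have "real n3 * x / real n3 = x" for x using n by simp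
  then show ?thesis unfolding eq tnorm_F_def tensors_dims[OF A n(2)] by (simp only: F_def power2_abs)
qed

lemma frobenius_udiag:
  assumes U: "orth m U"
  shows "(\<Sum>i<m. \<Sum>j<m. (udiag U d $$ (i, j))\<^sup>2) = (\<Sum>l<m. (d l)\<^sup>2)"
proof -
  note u = orthD[OF U]
  have D: "udiag U d \<in> carrier_mat m m" using u(1) by simp
  have sym: "udiag U d $$ (i, j) = udiag U d $$ (j, i)" if "i < m" "j < m" for i j
    using that by (simp add: udiag_index[OF u(1)] mult_ac)
  have "(\<Sum>j<m. (udiag U d $$ (i, j))\<^sup>2) = (\<Sum>l<m. U $$ (i, l) * (d l * d l) * U $$ (i, l))" if "i < m" for i
  proof -
    have "(udiag U d * udiag U d) $$ (i, i) = (\<Sum>j<m. udiag U d $$ (i, j) * udiag U d $$ (j, i))"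
      using that u(1) D by (simp add: scalar_prod_def atLeast0LessThan)
    also have "\<dots> = (\<Sum>j<m. (udiag U d $$ (i, j))\<^sup>2)"
      unfolding power2_eq_square
      by (intro sum.cong refl arg_cong2[of _ _ _ _ "(*)"] sym) (use that in auto)
    finally have "(\<Sum>j<m. (udiag U d $$ (i, j))\<^sup>2) = (udiag U d * udiag U d) $$ (i, i)" by (rule HOL.sym)
    then show ?thesis unfolding udiag_mult[OF U] using that by (simp add: udiag_index[OF u(1)])
  qed
  then have "(\<Sum>i<m. \<Sum>j<m. (udiag U d $$ (i, j))\<^sup>2) = (\<Sum>i<m. \<Sum>l<m. U $$ (i, l) * (d l * d l) * U $$ (i, l))"
    by (rule sum.cong[OF refl]) simp
  also have "\<dots> = (\<Sum>l<m. \<Sum>i<m. U $$ (i, l) * (d l * d l) * U $$ (i, l))" by (rule sum.swap)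
  also have "\<dots> = (\<Sum>l<m. (d l)\<^sup>2)"
  proof (rule sum.cong[OF refl])
    fix l assume "l \<in> {..<m}"
    then have l: "l < m" by simp
    have "(\<Sum>i<m. U $$ (i, l) * (d l * d l) * U $$ (i, l)) = (d l)\<^sup>2 * (transpose_mat U * U) $$ (l, l)"
      using l u(1) by (simp add: scalar_prod_def atLeast0LessThan sum_distrib_left power2_eq_square mult_ac)
    then show "(\<Sum>i<m. U $$ (i, l) * (d l * d l) * U $$ (i, l)) = (d l)\<^sup>2" unfolding u(2) using l by simp
  qed
  finally show ?thesis .
qed

lemma vec_norm2_orth:
  assumes U: "orth m U" and v: "v \<in> carrier_vec m"
  shows "vec_norm2 (transpose_mat U *\<^sub>v v) = vec_norm2 v" "vec_norm2 (U *\<^sub>v v) = vec_norm2 v"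
proof -
  note u = orthD[OF U]
  have iso: "(W *\<^sub>v v) \<bullet> (W *\<^sub>v v) = v \<bullet> v" if W: "W \<in> carrier_mat m m" and 1: "transpose_mat W * W = 1\<^sub>m m" for W
  proof -
    have "(W *\<^sub>v v) \<bullet> (W *\<^sub>v v) = (transpose_mat W *\<^sub>v (W *\<^sub>v v)) \<bullet> v"
      using W v by (intro transpose_vec_mult_scalar[of W m m, symmetric]) (auto intro: mult_mat_vec_carrier)
    also have "transpose_mat W *\<^sub>v (W *\<^sub>v v) = (transpose_mat W * W) *\<^sub>v v"
      using W v by (simp add: assoc_mult_mat_vec[of _ m m _ m])
    finally show ?thesis unfolding 1 using v by simp
  qed
  have "transpose_mat U \<in> carrier_mat m m" "transpose_mat (transpose_mat U) * transpose_mat U = 1\<^sub>m m"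
    using u by auto
  from iso[OF this] show "vec_norm2 (transpose_mat U *\<^sub>v v) = vec_norm2 v" by (simp only: vec_norm2_def)
  from iso[OF u(1,2)] show "vec_norm2 (U *\<^sub>v v) = vec_norm2 v" by (simp only: vec_norm2_def)
qed

lemma spectral_norm_udiag:
  assumes U: "orth m U" and m: "0 < m" and d: "\<And>i. i < m \<Longrightarrow> 0 \<le> d i" and max: "\<And>i. i < m \<Longrightarrow> d i \<le> d 0"
  shows "spectral_norm (udiag U d) = d 0"
proof -
  note u = orthD[OF U]
  have "dim_row U = m" using u by simp
  have sumsq: "w \<bullet> w = (\<Sum>l<m. (w $ l)\<^sup>2)" if "w \<in> carrier_vec m" for w :: "real vec"
    using that by (simp add: scalar_prod_def atLeast0LessThan power2_eq_square)
  have nrm: "vec_norm2 (udiag U d *\<^sub>v v) = sqrt (\<Sum>l<m. (d l)\<^sup>2 * ((transpose_mat U *\<^sub>v v) $ l)\<^sup>2)"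
    if v: "v \<in> carrier_vec m" for v
  proof -
    define w where "w = transpose_mat U *\<^sub>v v"
    have w: "w \<in> carrier_vec m" using u(1) by (simp add: w_def carrier_vecI)
    have D: "mat_diag m d *\<^sub>v w \<in> carrier_vec m" by (simp add: carrier_vecI mat_diag_def)
    have "udiag U d *\<^sub>v v = (U * mat_diag m d) *\<^sub>v w"
      unfolding udiag_def w_def \<open>dim_row U = m\<close>
      by (rule assoc_mult_mat_vec[of _ m m _ m]) (use u(1) v in auto)
    also have "\<dots> = U *\<^sub>v (mat_diag m d *\<^sub>v w)"
      by (rule assoc_mult_mat_vec[OF u(1) mat_diag_dim w])
    finally have "vec_norm2 (udiag U d *\<^sub>v v) = vec_norm2 (mat_diag m d *\<^sub>v w)"
      using vec_norm2_orth(2)[OF U D] by simp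
    also have "mat_diag m d *\<^sub>v w = vec m (\<lambda>l. d l * w $ l)"
    proof (intro eq_vecI)
      fix i assume "i < dim_vec (vec m (\<lambda>l. d l * w $ l))"
      then have i: "i < m" by simp
      then have "(mat_diag m d *\<^sub>v w) $ i = (\<Sum>l<m. (if i = l then d l else 0) * w $ l)"
        using w by (simp add: mat_diag_def scalar_prod_def atLeast0LessThan)
      also have "\<dots> = (\<Sum>l<m. if l = i then d l * w $ l else 0)" by (intro sum.cong) auto
      finally show "(mat_diag m d *\<^sub>v w) $ i = vec m (\<lambda>l. d l * w $ l) $ i" using i by (simp add: sum.delta)
    qed (simp add: mat_diag_def)
    also have "vec_norm2 \<dots> = sqrt (\<Sum>l<m. (d l)\<^sup>2 * (w $ l)\<^sup>2)"
      by (simp add: vec_norm2_def sumsq[OF vec_carrier] power_mult_distrib)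
    finally show ?thesis unfolding w_def .
  qed
  have sq: "(\<Sum>l<m. (w $ l)\<^sup>2) = (vec_norm2 w)\<^sup>2" if "w \<in> carrier_vec m" for w
    unfolding vec_norm2_def sumsq[OF that] by (rule real_sqrt_pow2[symmetric]) (simp add: sum_nonneg)
  show ?thesis
    unfolding spectral_norm_def
  proof (rule cSup_eq_maximum)
    let ?v = "col U 0"
    have v: "?v \<in> carrier_vec m" using u(1) by auto
    have w: "transpose_mat U *\<^sub>v ?v = unit_vec m 0"
    proof (intro eq_vecI)
      fix i assume "i < dim_vec (unit_vec m 0)"
      then have i: "i < m" by simp
      have "(transpose_mat U *\<^sub>v ?v) $ i = (transpose_mat U * U) $$ (i, 0)" using i m u(1) by simp
      then show "(transpose_mat U *\<^sub>v ?v) $ i = unit_vec m 0 $ i" unfolding u(2) using i m by (simp add: unit_vec_def)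
    qed (use u in simp)
    have "vec_norm2 ?v = vec_norm2 (unit_vec m 0)" using vec_norm2_orth(1)[OF U v] w by simp
    then have 1: "vec_norm2 ?v = 1" using m by (simp add: vec_norm2_def)
    have "(\<Sum>l<m. (d l)\<^sup>2 * (unit_vec m 0 $ l)\<^sup>2) = (\<Sum>l<m. if l = 0 then (d l)\<^sup>2 else 0)"
      by (intro sum.cong) (auto simp: unit_vec_def)
    then have "vec_norm2 (udiag U d *\<^sub>v ?v) = d 0"
      unfolding nrm[OF v] w using m d[OF m] by (simp add: sum.delta)
    then show "d 0 \<in> {vec_norm2 (udiag U d *\<^sub>v v) |v. v \<in> carrier_vec (dim_col (udiag U d)) \<and> vec_norm2 v = 1}"
      using v 1 \<open>dim_row U = m\<close> by (intro CollectI exI[of _ ?v]) simp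
    fix x assume "x \<in> {vec_norm2 (udiag U d *\<^sub>v v) |v. v \<in> carrier_vec (dim_col (udiag U d)) \<and> vec_norm2 v = 1}"
    then obtain v where v: "v \<in> carrier_vec m" "vec_norm2 v = 1" and x: "x = vec_norm2 (udiag U d *\<^sub>v v)"
      using \<open>dim_row U = m\<close> by auto
    have "(\<Sum>l<m. (d l)\<^sup>2 * ((transpose_mat U *\<^sub>v v) $ l)\<^sup>2) \<le> (\<Sum>l<m. (d 0)\<^sup>2 * ((transpose_mat U *\<^sub>v v) $ l)\<^sup>2)"
      using d max by (intro sum_mono mult_right_mono power_mono) auto
    also have "\<dots> = (d 0)\<^sup>2"
    proof -
      have "transpose_mat U *\<^sub>v v \<in> carrier_vec m" using u(1) by (simp add: carrier_vecI)
      from sq[OF this] have "(\<Sum>l<m. ((transpose_mat U *\<^sub>v v) $ l)\<^sup>2) = 1"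
        unfolding vec_norm2_orth(1)[OF U v(1)] v(2) by simp
      then show ?thesis unfolding sum_distrib_left[symmetric] by simp
    qed
    finally have le: "(\<Sum>l<m. (d l)\<^sup>2 * ((transpose_mat U *\<^sub>v v) $ l)\<^sup>2) \<le> (d 0)\<^sup>2" .
    have "x = sqrt (\<Sum>l<m. (d l)\<^sup>2 * ((transpose_mat U *\<^sub>v v) $ l)\<^sup>2)"
      by (rule trans[OF x nrm[OF v(1)]])
    also have "\<dots> \<le> sqrt ((d 0)\<^sup>2)" using le by (rule real_sqrt_le_mono)
    also have "\<dots> = d 0" using d[OF m] by (rule real_sqrt_unique[OF refl])
    finally show "x \<le> d 0" .
  qed
qed

lemma tnorm_tabs_powr:
  assumes C: "C \<in> tensors n n n3" and n: "0 < n" "0 < n3" and r: "0 < r"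
  shows "tnorm_F (tpowr (tabs C) r) = sqrt ((\<Sum>i<n * n3. svals (bcirc C) i powr (2 * r)) / real n3)"
    and "tnorm_2 (tpowr (tabs C) r) = svals (bcirc C) 0 powr r"
proof -
  obtain U where U: "orth (n * n3) U" "tpowr (tabs C) r \<in> tensors n n n3"
    "bcirc (tpowr (tabs C) r) = udiag U (\<lambda>i. svals (bcirc C) i powr r)"
    using bcirc_tabs_powr[OF C n] .
  have sq: "(x powr r)\<^sup>2 = x powr (2 * r)" for x :: real by (simp add: power2_eq_square flip: powr_add)
  show "tnorm_F (tpowr (tabs C) r) = sqrt ((\<Sum>i<n * n3. svals (bcirc C) i powr (2 * r)) / real n3)"
    unfolding tnorm_F_bcirc[OF U(2) n] U(3) frobenius_udiag[OF U(1)] sq ..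
  have "0 < n * n3" using n by simp
  then show "tnorm_2 (tpowr (tabs C) r) = svals (bcirc C) 0 powr r"
    unfolding tnorm_2_def U(3) using svals_props[OF bcirc_carrier[OF C n(2)]] r
    by (intro spectral_norm_udiag[OF U(1)]) (auto intro!: powr_mono2)
qed

text \<open>The tensor inequality is tested on the folded eigenvectors of \<open>bcirc A\<close>: for the \<open>l\<close>-th one the inner
  product is the eigenvalue \<open>d l\<close>.\<close>

lemma sym_tpsd_bcirc:
  assumes A: "sym_tpsd n n3 A" and n: "0 < n" "0 < n3"
  shows "\<exists>U d. orth (n * n3) U \<and> bcirc A = udiag U d \<and> (\<forall>i < n * n3. 0 \<le> d i)"
proof -
  let ?N = "n * n3"
  have At: "A \<in> tensors n n n3" and sym: "ttranspose A = A"
    and psd: "\<And>X. X \<in> tensors n 1 n3 \<Longrightarrow> X \<noteq> tzero n 1 n3 \<Longrightarrow> 0 \<le> tinner X (A *\<^sub>t X)"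
    using A unfolding sym_tpsd_def by blast+
  have M: "bcirc A \<in> carrier_mat ?N ?N" by (rule bcirc_carrier[OF At n(2)])
  have "transpose_mat (bcirc A) = bcirc A" using bcirc_ttranspose(2)[OF At n] sym by simp
  from symmetric_spectral[OF M this]
  obtain U d where U: "orth ?N U" and AU: "bcirc A = udiag U d" by blast
  note u = orthD[OF U]
  have lt: "a * n + i < ?N" if "a < n3" "i < n" for a i
  proof -
    have "a * n + i < Suc a * n" using that by simp
    also have "\<dots> \<le> n3 * n" using that by (intro mult_right_mono) auto
    finally show ?thesis by (simp add: mult.commute)
  qed
  have "0 \<le> d l" if l: "l < ?N" for l
  proof -
    define x where "x i = U $$ (i, l)" for i
    define X where "X = map (\<lambda>k. mat n 1 (\<lambda>(i, j). x (k * n + i))) [0..<n3]"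
    have X: "X \<in> tensors n 1 n3" by (auto simp: X_def tensors_def)
    note dX = tensors_dims[OF X n(2)]
    have xx: "(\<Sum>i<?N. x i * x i) = 1"
    proof -
      have "(\<Sum>i<?N. x i * x i) = (transpose_mat U * U) $$ (l, l)"
        using l u(1) by (simp add: scalar_prod_def atLeast0LessThan x_def)
      then show ?thesis unfolding u(2) using l by simp
    qed
    have Xnth: "X ! k $$ (i, 0) = x (k * n + i)" if "k < n3" "i < n" for k i
      using that by (simp add: X_def)
    have "X \<noteq> tzero n 1 n3"
    proof
      assume z: "X = tzero n 1 n3"
      have "x (k * n + i) = 0" if "k < n3" "i < n" for k i
        using Xnth[OF that] that unfolding z tzero_def by simp
      then have "(\<Sum>i<?N. x i * x i) = 0" unfolding sum_split_blocks by (intro sum.neutral) auto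
      then show False using xx by simp
    qed
    from psd[OF X this] have nn: "0 \<le> tinner X (A *\<^sub>t X)" .
    have unf: "tunfold X \<in> carrier_mat ?N 1" "tunfold X $$ (i, 0) = x i" if "i < ?N" for i
    proof -
      show "tunfold X \<in> carrier_mat ?N 1" by (simp add: tunfold_def dX)
      have "tunfold X $$ (i, 0) = bcirc X $$ (i, 0)" using that by (simp add: tunfold_def dX)
      also have "\<dots> = X ! (i div n) $$ (i mod n, 0)"
        using that n by (subst bcirc_index[OF X n(2)]) (auto simp: less_mult_imp_div_less mult.commute)
      also have "\<dots> = x i" using that n by (subst Xnth) (auto simp: less_mult_imp_div_less mult.commute)
      finally show "tunfold X $$ (i, 0) = x i" .
    qed
    have unfc: "tunfold X \<in> carrier_mat ?N 1" by (rule unf(1)[OF l])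
    have prod: "(A *\<^sub>t X) ! k $$ (i, 0) = d l * x (k * n + i)" if ki: "k < n3" "i < n" for k i
    proof -
      have dr: "dim_row (bcirc A) div n3 = n" using M n by simp
      have "(A *\<^sub>t X) ! k $$ (i, 0) = (bcirc A * tunfold X) $$ (k * n + i, 0)"
        unfolding tprod_def tfold_def Let_def using ki unfc dr n
        by (simp add: tensors_dims(1)[OF At n(2)] del: index_mult_mat(1))
      also have "\<dots> = (\<Sum>j<?N. udiag U d $$ (k * n + i, j) * U $$ (j, l))"
        using lt[OF ki] M unfc unf(2) unfolding AU by (auto simp: scalar_prod_def atLeast0LessThan x_def intro!: sum.cong)
      also have "\<dots> = (udiag U d * U) $$ (k * n + i, l)"
        using lt[OF ki] l u(1) by (simp add: scalar_prod_def atLeast0LessThan)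
      also have "\<dots> = d l * x (k * n + i)"
        unfolding udiag_mult_right[OF U] mat_diag_mult_right[OF u(1)] using lt[OF ki] l by (simp add: x_def)
      finally show ?thesis .
    qed
    have "tinner X (A *\<^sub>t X) = (\<Sum>k<n3. \<Sum>i<n. d l * (x (k * n + i) * x (k * n + i)))"
      unfolding tinner_def dX by (intro sum.cong refl) (simp add: Xnth prod)
    also have "\<dots> = d l * (\<Sum>i<?N. x i * x i)" unfolding sum_split_blocks by (simp add: sum_distrib_left)
    also have "\<dots> = d l" unfolding xx by simp
    finally show ?thesis using nn by simp
  qed
  then show ?thesis using U AU by blast
qed

section \<open>The norm inequalities\<close>

theorem theorem4p4:
  fixes n n3 :: nat and A X B :: tensor and r p q :: real
  assumes "0 < n" and "0 < n3"
    and "A \<in> tensors n n n3" and "X \<in> tensors n n n3" and "B \<in> tensors n n n3"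
    and "sym_tpsd n n3 A" and "sym_tpsd n n3 B"
    and "0 < r" and "0 < p" and "0 < q" and "1 / p + 1 / q = 1"
  shows "tnorm_F (tpowr (tabs (A *\<^sub>t X *\<^sub>t B)) r)
           \<le> real n3 powr (1 / (2 * p) + 1 / (2 * q) - 1 / 2)
             * tnorm_F (tpowr (tabs (tpowr A p *\<^sub>t X)) r) powr (1 / p)
             * tnorm_F (tpowr (tabs (X *\<^sub>t tpowr B q)) r) powr (1 / q)
       \<and> tnorm_2 (tpowr (tabs (A *\<^sub>t X *\<^sub>t B)) r)
           \<le> tnorm_2 (tpowr (tabs (tpowr A p *\<^sub>t X)) r) powr (1 / p)
             * tnorm_2 (tpowr (tabs (X *\<^sub>t tpowr B q)) r) powr (1 / q)"
proof -
  let ?N = "n * n3"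
  note n = \<open>0 < n\<close> \<open>0 < n3\<close>
  note At = \<open>A \<in> tensors n n n3\<close> and Xt = \<open>X \<in> tensors n n n3\<close> and Bt = \<open>B \<in> tensors n n n3\<close>
  note r = \<open>0 < r\<close> and p = \<open>0 < p\<close> and q = \<open>0 < q\<close> and pq = \<open>1 / p + 1 / q = 1\<close>
  obtain U a where U: "orth ?N U" and A: "bcirc A = udiag U a" and a: "\<And>i. i < ?N \<Longrightarrow> 0 \<le> a i"
    using sym_tpsd_bcirc[OF \<open>sym_tpsd n n3 A\<close> n] by blast
  obtain V b where V: "orth ?N V" and B: "bcirc B = udiag V b" and b: "\<And>i. i < ?N \<Longrightarrow> 0 \<le> b i"
    using sym_tpsd_bcirc[OF \<open>sym_tpsd n n3 B\<close> n] by blast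
  have X: "bcirc X \<in> carrier_mat ?N ?N" by (rule bcirc_carrier[OF Xt n(2)])
  have Ap: "tpowr A p \<in> tensors n n n3" "bcirc (tpowr A p) = udiag U (\<lambda>i. a i powr p)"
    by (rule bcirc_tpowr[OF At n U a A]; assumption)+
  have Bq: "tpowr B q \<in> tensors n n n3" "bcirc (tpowr B q) = udiag V (\<lambda>i. b i powr q)"
    by (rule bcirc_tpowr[OF Bt n V b B]; assumption)+
  note AX = bcirc_tprod[OF At Xt n]
  note AXB = bcirc_tprod[OF AX(1) Bt n]
  note ApX = bcirc_tprod[OF Ap(1) Xt n]
  note XBq = bcirc_tprod[OF Xt Bq(1) n]
  define M P Q where "M = bcirc (A *\<^sub>t X *\<^sub>t B)" and "P = bcirc (tpowr A p *\<^sub>t X)" and "Q = bcirc (X *\<^sub>t tpowr B q)"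
  have M: "M = udiag U a * bcirc X * udiag V b" unfolding M_def AXB(2) AX(2) A B ..
  have P: "P = ppow U a p * bcirc X" unfolding P_def ApX(2) Ap(2) ppow_def using p by simp
  have Q: "Q = bcirc X * ppow V b q" unfolding Q_def XBq(2) Bq(2) ppow_def using q by simp
  have Nge: "1 \<le> ?N" using n by simp
  define S where "S Y = (\<Sum>i<?N. svals Y i powr (2 * r))" for Y
  have S0: "0 \<le> S Y" for Y unfolding S_def by (intro sum_nonneg) auto
  have SM: "S M \<le> S P powr (1 / p) * S Q powr (1 / q)"
    unfolding S_def M P Q
    using schatten_interpolation[where a = a and b = b, OF U a V b X p q pq, of "2 * r"] r by simp
  have exponent: "1 / (2 * p) + 1 / (2 * q) - 1 / 2 = 0" using pq by (simp add: field_simps)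
  have "real n3 powr (1 / p) * real n3 powr (1 / q) = real n3"
    using n(2) pq by (simp flip: powr_add)
  then have div: "(S P / real n3) powr (1 / p) * (S Q / real n3) powr (1 / q) = S P powr (1 / p) * S Q powr (1 / q) / real n3"
    using S0 by (simp add: powr_divide)
  have "sqrt (S M / real n3) \<le> sqrt ((S P / real n3) powr (1 / p) * (S Q / real n3) powr (1 / q))"
    unfolding div using SM by (intro real_sqrt_le_mono divide_right_mono) auto
  also have "\<dots> = sqrt (S P / real n3) powr (1 / p) * sqrt (S Q / real n3) powr (1 / q)"
    using S0 by (simp add: real_sqrt_mult powr_half_sqrt[symmetric] powr_powr mult.commute)
  finally have F: "sqrt (S M / real n3) \<le> sqrt (S P / real n3) powr (1 / p) * sqrt (S Q / real n3) powr (1 / q)" .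
  have "kvol 1 M \<le> kvol 1 P powr (1 / p) * kvol 1 Q powr (1 / q)"
    unfolding M P Q by (rule kvol_interpolation[where a = a and b = b, OF U a V b X Nge p q pq])
  then have s0: "svals M 0 \<le> svals P 0 powr (1 / p) * svals Q 0 powr (1 / q)" by (simp add: kvol_def)
  have "0 \<le> svals M 0"
    using svals_props(1)[of M ?N 0] bcirc_carrier[OF AXB(1) n(2)] Nge by (simp add: M_def)
  then have "svals M 0 powr r \<le> (svals P 0 powr (1 / p) * svals Q 0 powr (1 / q)) powr r"
    using s0 r by (intro powr_mono2) auto
  also have "\<dots> = (svals P 0 powr r) powr (1 / p) * (svals Q 0 powr r) powr (1 / q)"
    by (simp add: powr_mult powr_powr mult.commute)
  finally have T: "svals M 0 powr r \<le> (svals P 0 powr r) powr (1 / p) * (svals Q 0 powr r) powr (1 / q)" .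
  show ?thesis
    unfolding tnorm_tabs_powr[OF AXB(1) n r] tnorm_tabs_powr[OF ApX(1) n r] tnorm_tabs_powr[OF XBq(1) n r] exponent
    using F T n unfolding S_def M_def P_def Q_def by simp
qed

end
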